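(* Let $A$ be a $\mathrm{C}^*$-algebra and let $H$ be a closed normal subgroup of $\mathrm{G}_A$. Let $I$ denote the closed two-sided ideal of $A$ generated by $[H,A]$. Then $\overline{(H,\mathrm{G}_A)}=\overline{(\mathrm{G}_I,\mathrm{G}_A)}$.
   Context: $A$ is not assumed unital. $A^\sim$ denotes the minimal unitization of $A$ ($A^\sim=A$ if $A$ is unital). $\mathrm{GL}(A)$ is the group of invertible elements of $A$ if $A$ is unital; if $A$ is non-unital, $\mathrm{GL}(A)$ is the group of invertible elements of $A^\sim$ of the form $1+x$ with $x\in A$. It carries the norm topology, and $\mathrm{G}_A$ denotes its connected component of the identity. For a closed two-sided ideal $I$ of $A$, $I^\sim$ is regarded as a subalgebra of $A^\sim$ (elements $\lambda 1+x$ with $x\in I$, with $1$ the unit of $A^\sim$), and in this way $\mathrm{G}_I$ is regarded as a closed normal subgroup of $\mathrm{G}_A$. Write $[x,y]=xy-yx$ and $(x,y)=xyx^{-1}y^{-1}$ (for invertible $x,y$). For sets, $[X,Y]$ is the linear span of $\{[x,y]: x\in X,y\in Y\}$ and $(X,Y)$ is the subgroup generated by $\{(x,y): x\in X,y\in Y\}$. Overlines denote norm closure; "closed" means norm closed. *)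

theory Defs
  imports "HOL-Analysis.Analysis" "HOL-Algebra.Generated_Groups"
begin

section \<open>C*-algebras\<close>

text \<open>
  The distribution has no class of complex normed spaces, so the complex scalar multiplication is
  added on top of the real one.  No unit is assumed.
\<close>

class cstar_algebra = real_normed_algebra + complete_space +
  fixes scaleC :: "complex \<Rightarrow> 'a \<Rightarrow> 'a"  (infixr \<open>*\<^sub>C\<close> 75)
    and star :: "'a \<Rightarrow> 'a"
  assumes scaleC_add_right: "c *\<^sub>C (x + y) = c *\<^sub>C x + c *\<^sub>C y"
    and scaleC_add_left: "(c + d) *\<^sub>C x = c *\<^sub>C x + d *\<^sub>C x"
    and scaleC_scaleC: "c *\<^sub>C d *\<^sub>C x = (c * d) *\<^sub>C x"
    and scaleC_of_real: "of_real r *\<^sub>C x = r *\<^sub>R x"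
    and mult_scaleC_left: "(c *\<^sub>C x) * y = c *\<^sub>C (x * y)"
    and mult_scaleC_right: "x * (c *\<^sub>C y) = c *\<^sub>C (x * y)"
    and norm_scaleC: "norm (c *\<^sub>C x) = cmod c * norm x"
    and star_star: "star (star x) = x"
    and star_add: "star (x + y) = star x + star y"
    and star_scaleC: "star (c *\<^sub>C x) = cnj c *\<^sub>C star x"
    and star_mult: "star (x * y) = star y * star x"
    and cstar_identity: "norm (star x * x) = (norm x)\<^sup>2"

lemma scaleC_one: "1 *\<^sub>C (x :: 'a::cstar_algebra) = x"
  using scaleC_of_real[of 1 x] by simp

global_interpretation complex_vector:
  vector_space "scaleC :: complex \<Rightarrow> 'a \<Rightarrow> 'a::cstar_algebra"
  by standard (simp_all add: scaleC_add_right scaleC_add_left scaleC_scaleC scaleC_one)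

lemma bounded_linear_scaleC: "bounded_linear (\<lambda>x :: 'a::cstar_algebra. c *\<^sub>C x)"
proof (rule bounded_linear_intro)
  fix x y :: 'a and r :: real
  show "c *\<^sub>C (x + y) = c *\<^sub>C x + c *\<^sub>C y" by (rule scaleC_add_right)
  show "c *\<^sub>C r *\<^sub>R x = r *\<^sub>R c *\<^sub>C x"
    by (simp add: scaleC_of_real[symmetric] scaleC_scaleC mult.commute)
  show "norm (c *\<^sub>C x) \<le> norm x * cmod c" by (simp add: norm_scaleC)
qed

lemma norm_star_le: "norm (x :: 'a::cstar_algebra) \<le> norm (star x)"
proof (cases "norm x = 0")
  case False
  have "norm x * norm x \<le> norm (star x) * norm x"
    using norm_mult_ineq[of "star x" x] by (simp add: cstar_identity power2_eq_square)
  with False show ?thesis by simp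
qed simp

lemma norm_star: "norm (star x) = norm (x :: 'a::cstar_algebra)"
  using norm_star_le[of x] norm_star_le[of "star x"] by (simp add: star_star)

lemma star_mult_eq_0D:
  assumes "\<And>a. star a * z = 0"
  shows "(z :: 'a::cstar_algebra) = 0"
  using cstar_identity[of z] assms[of z] by simp

definition unital_cstar :: "'a::cstar_algebra itself \<Rightarrow> bool"
  where "unital_cstar _ \<longleftrightarrow> (\<exists>e :: 'a. \<forall>x. e * x = x \<and> x * e = x)"

definition closed_ideal :: "'a::cstar_algebra set \<Rightarrow> bool"
  where "closed_ideal I \<longleftrightarrow>
    closed I \<and> complex_vector.subspace I \<and> (\<forall>a. \<forall>x\<in>I. a * x \<in> I \<and> x * a \<in> I)"


lemma closed_ideal_UNIV: "closed_ideal UNIV"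
  by (simp add: closed_ideal_def complex_vector.subspace_def)

lemma closed_ideal_hull: "closed_ideal (closed_ideal hull S)"
proof (rule hull_in)
  fix T :: "'a set set"
  assume "Ball T closed_ideal"
  then show "closed_ideal (\<Inter>T)"
    unfolding closed_ideal_def by (auto intro!: closed_Inter complex_vector.subspace_Inter)
qed


section \<open>The minimal unitization\<close>

text \<open>
  The minimal unitization of \<open>A\<close> is realized as the algebra of all operators \<open>y \<mapsto> \<lambda> y + x y\<close> on \<open>A\<close>,
  with \<open>\<lambda>\<close> a complex number and \<open>x\<close> in \<open>A\<close>, under the operator norm.  If \<open>A\<close> is not unital, \<open>\<lambda>\<close> and \<open>x\<close> are
  determined by the operator and this is the usual construction of the C*-norm on the vector
  space \<open>\<complex> \<oplus> A\<close>.  If \<open>A\<close> is unital, the identity operator is the left multiplication by the unit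
  of \<open>A\<close>, and so the unitization is \<open>A\<close> itself (lemma \<open>range_emb_iff_unital\<close> below).
\<close>

typedef (overloaded) ('a::cstar_algebra) unitization =
  "{T :: 'a \<Rightarrow>\<^sub>L 'a. \<exists>c x. \<forall>y. blinfun_apply T y = c *\<^sub>C y + x * y}"
  morphisms op_of Abs_unitization
proof
  show "(0 :: 'a \<Rightarrow>\<^sub>L 'a) \<in> {T. \<exists>c x. \<forall>y. blinfun_apply T y = c *\<^sub>C y + x * y}"
    by (auto intro!: exI[of _ 0])
qed

setup_lifting type_definition_unitization

abbreviation act :: "'a::cstar_algebra unitization \<Rightarrow> 'a \<Rightarrow> 'a"
  where "act u \<equiv> blinfun_apply (op_of u)"

lemma unitization_eqI: "(\<And>y. act u y = act v y) \<Longrightarrow> u = v"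
  by (simp add: op_of_inject[symmetric] blinfun_eqI)

lemma act_form: obtains c x where "\<And>y. act u y = c *\<^sub>C y + x * y"
  using op_of[of u] by auto

lemma act_mult: "act u (y * z) = act u y * z"
proof -
  obtain c x where "\<And>y. act u y = c *\<^sub>C y + x * y" using act_form by blast
  then show ?thesis by (simp add: distrib_right mult.assoc mult_scaleC_left)
qed

lemma act_scaleC: "act u (c *\<^sub>C y) = c *\<^sub>C act u y"
proof -
  obtain d x where "\<And>y. act u y = d *\<^sub>C y + x * y" using act_form by blast
  then show ?thesis
    by (simp add: scaleC_add_right scaleC_scaleC mult_scaleC_right mult.commute)
qed

instantiation unitization :: (cstar_algebra) real_normed_algebra
begin

lift_definition zero_unitization :: "'a unitization" is 0
  by (auto intro!: exI[of _ 0])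

lift_definition plus_unitization :: "'a unitization \<Rightarrow> 'a unitization \<Rightarrow> 'a unitization" is "(+)"
proof -
  fix S T :: "'a \<Rightarrow>\<^sub>L 'a"
  assume "\<exists>c x. \<forall>y. blinfun_apply S y = c *\<^sub>C y + x * y"
    and "\<exists>c x. \<forall>y. blinfun_apply T y = c *\<^sub>C y + x * y"
  then obtain c x d z where "\<And>y. blinfun_apply S y = c *\<^sub>C y + x * y"
    and "\<And>y. blinfun_apply T y = d *\<^sub>C y + z * y" by auto
  then show "\<exists>c x. \<forall>y. blinfun_apply (S + T) y = c *\<^sub>C y + x * y"
    by (intro exI[of _ "c + d"] exI[of _ "x + z"])
      (simp add: blinfun.add_left scaleC_add_left distrib_right)
qed

lift_definition uminus_unitization :: "'a unitization \<Rightarrow> 'a unitization" is uminus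
proof -
  fix S :: "'a \<Rightarrow>\<^sub>L 'a"
  assume "\<exists>c x. \<forall>y. blinfun_apply S y = c *\<^sub>C y + x * y"
  then obtain c x where "\<And>y. blinfun_apply S y = c *\<^sub>C y + x * y" by auto
  then show "\<exists>c x. \<forall>y. blinfun_apply (- S) y = c *\<^sub>C y + x * y"
    by (intro exI[of _ "- c"] exI[of _ "- x"]) (simp add: blinfun.minus_left)
qed

definition minus_unitization :: "'a unitization \<Rightarrow> 'a unitization \<Rightarrow> 'a unitization"
  where "minus_unitization u v = u + - v"

lift_definition scaleR_unitization :: "real \<Rightarrow> 'a unitization \<Rightarrow> 'a unitization" is scaleR
proof -
  fix r :: real and S :: "'a \<Rightarrow>\<^sub>L 'a"
  assume "\<exists>c x. \<forall>y. blinfun_apply S y = c *\<^sub>C y + x * y"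
  then obtain c x where "\<And>y. blinfun_apply S y = c *\<^sub>C y + x * y" by auto
  then show "\<exists>c x. \<forall>y. blinfun_apply (r *\<^sub>R S) y = c *\<^sub>C y + x * y"
    by (intro exI[of _ "of_real r * c"] exI[of _ "r *\<^sub>R x"])
      (simp add: blinfun.scaleR_left scaleC_of_real[symmetric] scaleC_add_right scaleC_scaleC
        mult_scaleC_left)
qed

lift_definition times_unitization :: "'a unitization \<Rightarrow> 'a unitization \<Rightarrow> 'a unitization"
  is "(o\<^sub>L)"
proof -
  fix S T :: "'a \<Rightarrow>\<^sub>L 'a"
  assume "\<exists>c x. \<forall>y. blinfun_apply S y = c *\<^sub>C y + x * y"
    and "\<exists>c x. \<forall>y. blinfun_apply T y = c *\<^sub>C y + x * y"
  then obtain c x d z where "\<And>y. blinfun_apply S y = c *\<^sub>C y + x * y"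
    and "\<And>y. blinfun_apply T y = d *\<^sub>C y + z * y" by auto
  then show "\<exists>c x. \<forall>y. blinfun_apply (S o\<^sub>L T) y = c *\<^sub>C y + x * y"
    by (intro exI[of _ "c * d"] exI[of _ "c *\<^sub>C z + d *\<^sub>C x + x * z"])
      (simp add: scaleC_add_right scaleC_scaleC distrib_left distrib_right mult.assoc
        mult_scaleC_left mult_scaleC_right)
qed

lift_definition norm_unitization :: "'a unitization \<Rightarrow> real" is norm .

definition dist_unitization :: "'a unitization \<Rightarrow> 'a unitization \<Rightarrow> real"
  where "dist_unitization u v = norm (u - v)"

definition sgn_unitization :: "'a unitization \<Rightarrow> 'a unitization"
  where "sgn_unitization u = scaleR (inverse (norm u)) u"

definition [code del]: "(uniformity :: ('a unitization \<times> 'a unitization) filter) =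
  (INF e\<in>{0 <..}. principal {(x, y). dist x y < e})"

definition open_unitization :: "'a unitization set \<Rightarrow> bool"
  where [code del]:
    "open_unitization S = (\<forall>x\<in>S. \<forall>\<^sub>F (x', y) in uniformity. x' = x \<longrightarrow> y \<in> S)"

instance
proof
  fix u v w :: "'a unitization" and r s :: real
  show "u + v + w = u + (v + w)" by transfer simp
  show "u + v = v + u" by transfer simp
  show "0 + u = u" by transfer simp
  show "- u + u = 0" by transfer simp
  show "u - v = u + - v" by (rule minus_unitization_def)
  show "r *\<^sub>R (u + v) = r *\<^sub>R u + r *\<^sub>R v" by transfer (simp add: scaleR_add_right)
  show "(r + s) *\<^sub>R u = r *\<^sub>R u + s *\<^sub>R u" by transfer (simp add: scaleR_add_left)
  show "r *\<^sub>R s *\<^sub>R u = (r * s) *\<^sub>R u" by transfer simp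
  show "1 *\<^sub>R u = u" by transfer simp
  show "u * v * w = u * (v * w)" by transfer (simp add: blinfun_eqI)
  show "(u + v) * w = u * w + v * w"
    by transfer (simp add: blinfun_eqI blinfun.bilinear_simps)
  show "u * (v + w) = u * v + u * w"
    by transfer (simp add: blinfun_eqI blinfun.bilinear_simps)
  show "(r *\<^sub>R u) * v = r *\<^sub>R (u * v)"
    by transfer (simp add: blinfun_eqI blinfun.bilinear_simps)
  show "u * (r *\<^sub>R v) = r *\<^sub>R (u * v)"
    by transfer (simp add: blinfun_eqI blinfun.bilinear_simps)
  show "dist u v = norm (u - v)" by (rule dist_unitization_def)
  show "sgn u = inverse (norm u) *\<^sub>R u" by (rule sgn_unitization_def)
  show "norm u = 0 \<longleftrightarrow> u = 0" by transfer simp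
  show "norm (u + v) \<le> norm u + norm v" by transfer (rule norm_triangle_ineq)
  show "norm (r *\<^sub>R u) = \<bar>r\<bar> * norm u" by transfer simp
  show "norm (u * v) \<le> norm u * norm v" by transfer (rule norm_blinfun_compose)
qed (rule uniformity_unitization_def open_unitization_def)+

end

text \<open>
  The class of unital rings requires \<open>0 \<noteq> 1\<close>, which fails here for the zero algebra.
\<close>

instantiation unitization :: (cstar_algebra) monoid_mult
begin

lift_definition one_unitization :: "'a unitization" is id_blinfun
  by (rule exI[of _ 1], rule exI[of _ 0]) (simp add: scaleC_one)

instance
  by standard (transfer, simp add: blinfun_eqI)+

end

lift_definition emb :: "'a::cstar_algebra \<Rightarrow> 'a unitization" is blinfun_mult_right
proof -
  fix x :: 'a
  show "\<exists>c z. \<forall>y. blinfun_apply (blinfun_mult_right x) y = c *\<^sub>C y + z * y"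
    by (rule exI[of _ 0], rule exI[of _ x]) simp
qed

lemma act_simps [simp]:
  "act 0 y = 0" "act 1 y = y" "act (u + v) y = act u y + act v y" "act (- u) y = - act u y"
  "act (u * v) y = act u (act v y)"
  "act (r *\<^sub>R u) y = r *\<^sub>R act u y" "act (emb x) y = x * y"
  by (simp_all add: zero_unitization.rep_eq one_unitization.rep_eq plus_unitization.rep_eq
      uminus_unitization.rep_eq times_unitization.rep_eq scaleR_unitization.rep_eq emb.rep_eq
      blinfun.bilinear_simps)

lemma act_diff [simp]: "act (u - v) y = act u y - act v y"
  unfolding minus_unitization_def act_simps by (rule diff_conv_add_uminus[symmetric])

lemma norm_act_le: "norm (act u y) \<le> norm u * norm y"
  by (simp add: norm_unitization.rep_eq norm_blinfun)

lemma norm_unitization_le: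
  assumes "0 \<le> b" "\<And>y. norm (act u y) \<le> b * norm y"
  shows "norm u \<le> b"
  using assms by (simp add: norm_unitization.rep_eq norm_blinfun_bound)

lemma emb_mult: "emb (x * y) = emb x * emb y"
  by (rule unitization_eqI) (simp add: mult.assoc)

lemma mult_emb: "u * emb x = emb (act u x)"
  by (rule unitization_eqI) (simp add: act_mult)

lemma norm_emb: "norm (emb x) = norm x"
proof (rule antisym)
  show "norm (emb x) \<le> norm x"
    by (rule norm_unitization_le) (simp_all add: norm_mult_ineq)
  show "norm x \<le> norm (emb x)"
  proof (cases "norm x = 0")
    case False
    have "norm x * norm x = norm (act (emb x) (star x))"
      using cstar_identity[of "star x"] by (simp add: star_star norm_star power2_eq_square)
    also have "\<dots> \<le> norm (emb x) * norm x"
      using norm_act_le[of "emb x" "star x"] by (simp add: norm_star)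
    finally show ?thesis using False by simp
  qed simp
qed

lemma bounded_linear_emb: "bounded_linear emb"
proof (rule bounded_linear_intro)
  fix x y :: 'a and r :: real
  show "emb (x + y) = emb x + emb y" by (rule unitization_eqI) (simp add: distrib_right)
  show "emb (r *\<^sub>R x) = r *\<^sub>R emb x" by (rule unitization_eqI) simp
  show "norm (emb x) \<le> norm x * 1" by (simp add: norm_emb)
qed

lemma inj_emb: "inj emb"
proof (rule injI)
  fix x y :: 'a assume "emb x = emb y"
  then have "norm (emb (x - y)) = 0" by (simp add: linear_diff[OF bounded_linear.linear[OF bounded_linear_emb]])
  then show "x = y" by (simp add: norm_emb)
qed

text \<open>
  The involution takes an operator to its adjoint for the \<open>A\<close>-valued inner product
  \<open>(a, b) \<mapsto> star a * b\<close>, so \<open>\<lambda> 1 + x\<close> to \<open>cnj \<lambda> 1 + star x\<close> (lemmas \<open>star_one\<close>, \<open>star_emb\<close>).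
\<close>

instantiation unitization :: (cstar_algebra) cstar_algebra
begin

lift_definition scaleC_unitization :: "complex \<Rightarrow> 'a unitization \<Rightarrow> 'a unitization"
  is "\<lambda>c T. Blinfun ((*\<^sub>C) c) o\<^sub>L T"
proof -
  fix c and S :: "'a \<Rightarrow>\<^sub>L 'a"
  assume "\<exists>c x. \<forall>y. blinfun_apply S y = c *\<^sub>C y + x * y"
  then obtain d x where "\<And>y. blinfun_apply S y = d *\<^sub>C y + x * y" by auto
  then show "\<exists>d x. \<forall>y. blinfun_apply (Blinfun ((*\<^sub>C) c) o\<^sub>L S) y = d *\<^sub>C y + x * y"
    by (intro exI[of _ "c * d"] exI[of _ "c *\<^sub>C x"])
      (simp add: bounded_linear_Blinfun_apply[OF bounded_linear_scaleC] scaleC_add_right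
        scaleC_scaleC mult_scaleC_left)
qed

definition star_unitization :: "'a unitization \<Rightarrow> 'a unitization"
  where "star_unitization u = (THE v. \<forall>a b. star (act u a) * b = star a * act v b)"

lemma act_scaleC_left [simp]: "act (c *\<^sub>C u) y = c *\<^sub>C act u y"
  by (simp add: scaleC_unitization.rep_eq bounded_linear_Blinfun_apply[OF bounded_linear_scaleC])

lemma unitization_form: obtains c x where "u = c *\<^sub>C 1 + emb (x :: 'a)"
proof -
  obtain c x where "\<And>y. act u y = c *\<^sub>C y + x * y" using act_form by blast
  then have "u = c *\<^sub>C 1 + emb x" by (intro unitization_eqI) simp
  then show ?thesis by (rule that)
qed

lemma star_unitization_eqI:
  assumes "\<And>a b :: 'a. star (act u a) * b = star a * act v b"
  shows "star u = v"
  unfolding star_unitization_def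
proof (rule the_equality)
  fix w assume w: "\<forall>a b. star (act u a) * b = star a * act w b"
  show "w = v"
  proof (rule unitization_eqI)
    fix b
    have "act w b - act v b = 0"
      by (rule star_mult_eq_0D) (simp add: right_diff_distrib w[rule_format, symmetric] assms)
    then show "act w b = act v b" by simp
  qed
qed (simp add: assms)

lemma act_star: "star (act u a) * b = star a * act (star u) (b :: 'a)"
proof -
  obtain c x where u: "u = c *\<^sub>C 1 + emb x" by (rule unitization_form)
  have *: "star (act u a) * b = star a * act (cnj c *\<^sub>C 1 + emb (star x)) b" for a b
    by (simp add: u star_add star_scaleC star_mult distrib_left distrib_right mult.assoc
        mult_scaleC_left mult_scaleC_right)
  show ?thesis using star_unitization_eqI[of u, OF *] * by simp
qed

lemma act_star': "star (act (star u) a) * b = star a * act u (b :: 'a)"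
proof -
  have "star (act (star u) a) * b = star (star b * act (star u) a)"
    by (simp add: star_mult star_star)
  also have "\<dots> = star (star (act u b) * a)" by (simp only: act_star)
  also have "\<dots> = star a * act u b" by (simp add: star_mult star_star)
  finally show ?thesis .
qed

lemma scaleC_norm_le: "norm (c *\<^sub>C u) \<le> cmod c * norm (u :: 'a unitization)"
proof (rule norm_unitization_le)
  fix y
  show "norm (act (c *\<^sub>C u) y) \<le> cmod c * norm u * norm y"
    using mult_left_mono[OF norm_act_le[of u y], of "cmod c"] by (simp add: norm_scaleC mult.assoc)
qed simp

lemma norm_scaleC_unitization: "norm (c *\<^sub>C u) = cmod c * norm (u :: 'a unitization)"
proof (cases "c = 0")
  case True
  then show ?thesis using scaleC_norm_le[of c u] by simp
next
  case False
  have "norm u = norm (inverse c *\<^sub>C c *\<^sub>C u)"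
    by (rule arg_cong[of _ _ norm], rule unitization_eqI)
      (simp add: scaleC_scaleC False scaleC_one)
  also have "\<dots> \<le> cmod (inverse c) * norm (c *\<^sub>C u)" by (rule scaleC_norm_le)
  finally have "cmod c * norm u \<le> norm (c *\<^sub>C u)"
    using False by (simp add: norm_inverse norm_divide field_simps)
  then show ?thesis using scaleC_norm_le[of c u] by simp
qed

lemma norm_square_le: "(norm u)\<^sup>2 \<le> norm (star u * (u :: 'a unitization))"
proof -
  have "norm u \<le> sqrt (norm (star u * u))"
  proof (rule norm_unitization_le)
    fix a
    have "(norm (act u a))\<^sup>2 = norm (star a * act (star u * u) a)"
      by (simp add: cstar_identity[symmetric] act_star)
    also have "\<dots> \<le> norm a * (norm (star u * u) * norm a)"
      by (rule order_trans[OF norm_mult_ineq])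
        (auto simp: norm_star simp del: act_simps intro!: mult_left_mono norm_act_le)
    also have "\<dots> = (sqrt (norm (star u * u)) * norm a)\<^sup>2"
      by (simp add: power_mult_distrib power2_eq_square mult_ac)
    finally show "norm (act u a) \<le> sqrt (norm (star u * u)) * norm a"
      by (rule power2_le_imp_le) simp
  qed simp
  then have "(norm u)\<^sup>2 \<le> (sqrt (norm (star u * u)))\<^sup>2" by (rule power_mono) simp
  then show ?thesis by simp
qed

lemma complete_range_emb: "complete (range (emb :: 'a \<Rightarrow> _))"
  by (rule complete_isometric_image[where e = 1])
    (auto simp: bounded_linear_emb norm_emb complete_UNIV)

lemma Cauchy_convergent_unitization:
  fixes X :: "nat \<Rightarrow> 'a unitization"
  assumes X: "Cauchy X"
  shows "convergent X"
proof (cases "1 \<in> range (emb :: 'a \<Rightarrow> _)")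
  case True
  then obtain e :: 'a where e: "1 = emb e" by auto
  have "u \<in> range emb" for u :: "'a unitization"
    using mult_emb[of u e] by (simp add: e[symmetric])
  then show ?thesis using complete_range_emb X by (auto simp: complete_def convergent_def)
next
  case False
  have "closed (range (emb :: 'a \<Rightarrow> _))" by (rule complete_imp_closed[OF complete_range_emb])
  then have "\<exists>d>0. ball 1 d \<subseteq> - range (emb :: 'a \<Rightarrow> _)"
    using False by (auto simp: closed_def open_contains_ball)
  then obtain d where "d > 0" and ball: "ball 1 d \<subseteq> - range (emb :: 'a \<Rightarrow> _)" by blast
  then have d: "d > 0" "\<And>v. v \<in> range (emb :: 'a \<Rightarrow> _) \<Longrightarrow> d \<le> dist 1 v"
    by (auto simp: subset_iff not_less[symmetric])
  have lower: "d * cmod c \<le> norm (c *\<^sub>C 1 + emb x)" for c and x :: 'a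
  proof (cases "c = 0")
    case False
    have eq: "c *\<^sub>C 1 + emb x = c *\<^sub>C (1 - emb (- (inverse c *\<^sub>C x)))"
      by (rule unitization_eqI)
        (simp add: scaleC_add_right scaleC_scaleC False mult_scaleC_left scaleC_one)
    have "d \<le> norm (1 - emb (- (inverse c *\<^sub>C x)))"
      using d(2)[of "emb (- (inverse c *\<^sub>C x))"] by (simp add: dist_norm)
    then show ?thesis unfolding eq norm_scaleC_unitization
      by (subst mult.commute) (rule mult_left_mono, simp_all)
  qed simp
  have "\<forall>n. \<exists>c x. X n = c *\<^sub>C 1 + emb x" using unitization_form by meson
  then obtain c x where cx: "\<And>n. X n = c n *\<^sub>C 1 + emb (x n)" by metis
  have diff: "X m - X n = (c m - c n) *\<^sub>C 1 + emb (x m - x n)" for m n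
    by (rule unitization_eqI) (simp add: cx left_diff_distrib complex_vector.scale_left_diff_distrib)
  have "Cauchy c"
  proof (rule CauchyI)
    fix e :: real assume "0 < e"
    with d X obtain M where "\<And>m n. m \<ge> M \<Longrightarrow> n \<ge> M \<Longrightarrow> norm (X m - X n) < d * e"
      using CauchyD[of X "d * e"] by (auto simp: mult_pos_pos)
    then have "d * cmod (c m - c n) < d * e" if "m \<ge> M" "n \<ge> M" for m n
      using that lower[of "c m - c n" "x m - x n"] unfolding diff by (meson le_less_trans)
    then show "\<exists>M. \<forall>m\<ge>M. \<forall>n\<ge>M. norm (c m - c n) < e"
      using d(1) by (auto intro!: exI[of _ M])
  qed
  then obtain c0 where c0: "c \<longlonglongrightarrow> c0" by (auto simp: Cauchy_convergent_iff convergent_def)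
  have "(\<lambda>n. c n *\<^sub>C 1) \<longlonglongrightarrow> c0 *\<^sub>C (1 :: 'a unitization)"
  proof (rule LIM_zero_cancel, rule tendsto_norm_zero_cancel)
    have "norm (c n *\<^sub>C 1 - c0 *\<^sub>C (1 :: 'a unitization)) = cmod (c n - c0) * norm (1 :: 'a unitization)"
      for n unfolding norm_scaleC_unitization[symmetric]
      by (rule arg_cong[of _ _ norm], rule unitization_eqI)
        (simp add: complex_vector.scale_left_diff_distrib)
    moreover have "(\<lambda>n. cmod (c n - c0) * norm (1 :: 'a unitization)) \<longlonglongrightarrow> 0"
      using tendsto_mult_right[OF tendsto_norm_zero[OF LIM_zero[OF c0]], of "norm (1 :: 'a unitization)"]
      by simp
    ultimately show "(\<lambda>n. norm (c n *\<^sub>C 1 - c0 *\<^sub>C (1 :: 'a unitization))) \<longlonglongrightarrow> 0" by simp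
  qed
  note c1 = this
  have "Cauchy (\<lambda>n. emb (x n))"
  proof (rule CauchyI)
    fix e :: real assume "0 < e"
    then have "0 < e / 2" by simp
    from CauchyD[OF X this] CauchyD[OF LIMSEQ_imp_Cauchy[OF c1] this]
    obtain M N where M: "\<And>m n. m \<ge> M \<Longrightarrow> n \<ge> M \<Longrightarrow> norm (X m - X n) < e / 2"
      and N: "\<And>m n. m \<ge> N \<Longrightarrow> n \<ge> N \<Longrightarrow> norm (c m *\<^sub>C 1 - c n *\<^sub>C (1 :: 'a unitization)) < e / 2"
      by blast
    have "norm (emb (x m) - emb (x n)) < e" if "m \<ge> max M N" "n \<ge> max M N" for m n
    proof -
      have "emb (x m) - emb (x n) = (X m - X n) - (c m *\<^sub>C 1 - c n *\<^sub>C 1)" by (simp add: cx)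
      then have "norm (emb (x m) - emb (x n)) \<le> norm (X m - X n) + norm (c m *\<^sub>C 1 - c n *\<^sub>C (1 :: 'a unitization))"
        by (metis norm_triangle_ineq4)
      then show ?thesis using M[of m n] N[of m n] that by simp
    qed
    then show "\<exists>M. \<forall>m\<ge>M. \<forall>n\<ge>M. norm (emb (x m) - emb (x n)) < e" by blast
  qed
  then obtain z where "(\<lambda>n. emb (x n)) \<longlonglongrightarrow> z"
    using complete_range_emb by (fastforce simp: complete_def)
  with c1 have "(\<lambda>n. c n *\<^sub>C 1 + emb (x n)) \<longlonglongrightarrow> c0 *\<^sub>C 1 + z" by (rule tendsto_add)
  then have "X \<longlonglongrightarrow> c0 *\<^sub>C 1 + z" by (simp add: cx[symmetric])
  then show ?thesis by (rule convergentI)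
qed

instance
proof
  fix u v :: "'a unitization" and c d :: complex and r :: real
  show "convergent X" if "Cauchy X" for X :: "nat \<Rightarrow> 'a unitization"
    using that by (rule Cauchy_convergent_unitization)
  show "c *\<^sub>C (u + v) = c *\<^sub>C u + c *\<^sub>C v"
    by (rule unitization_eqI) (simp add: scaleC_add_right)
  show "(c + d) *\<^sub>C u = c *\<^sub>C u + d *\<^sub>C u"
    by (rule unitization_eqI) (simp add: scaleC_add_left)
  show "c *\<^sub>C d *\<^sub>C u = (c * d) *\<^sub>C u"
    by (rule unitization_eqI) (simp add: scaleC_scaleC)
  show "of_real r *\<^sub>C u = r *\<^sub>R u"
    by (rule unitization_eqI) (simp add: scaleC_of_real)
  show "(c *\<^sub>C u) * v = c *\<^sub>C (u * v)"
    by (rule unitization_eqI) simp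
  show "u * (c *\<^sub>C v) = c *\<^sub>C (u * v)"
    by (rule unitization_eqI) (simp add: act_scaleC)
  show "norm (c *\<^sub>C u) = cmod c * norm u" by (rule norm_scaleC_unitization)
  show ss: "star (star u) = u" for u :: "'a unitization"
    by (rule star_unitization_eqI) (rule act_star')
  show "star (u + v) = star u + star v"
    by (rule star_unitization_eqI) (simp add: star_add distrib_left distrib_right act_star)
  show "star (c *\<^sub>C u) = cnj c *\<^sub>C star u"
    by (rule star_unitization_eqI)
      (simp add: star_scaleC mult_scaleC_left mult_scaleC_right act_star)
  show "star (u * v) = star v * star u"
    by (rule star_unitization_eqI) (simp add: act_star)
  show "norm (star u * u) = (norm u)\<^sup>2"
  proof -
    have le: "norm w \<le> norm (star w)" for w :: "'a unitization"
    proof (cases "norm w = 0")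
      case False
      have "norm w * norm w \<le> norm (star w) * norm w"
        using order_trans[OF norm_square_le norm_mult_ineq, of w] by (simp add: power2_eq_square)
      with False show ?thesis by simp
    qed simp
    have "norm (star u) = norm u" using le[of u] le[of "star u"] by (simp add: ss)
    then have "norm (star u * u) \<le> (norm u)\<^sup>2"
      using norm_mult_ineq[of "star u" u] by (simp add: power2_eq_square)
    with norm_square_le[of u] show ?thesis by simp
  qed
qed

end

lemma emb_scaleC: "emb (c *\<^sub>C x) = c *\<^sub>C emb x"
  by (rule unitization_eqI) (simp add: mult_scaleC_left)

lemma star_emb: "star (emb x) = emb (star x)"
  by (rule star_unitization_eqI) (simp add: star_mult mult.assoc)

lemma star_one: "star 1 = (1 :: 'a::cstar_algebra unitization)"
  by (rule star_unitization_eqI) simp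

lemma range_emb_iff_unital:
  "range (emb :: 'a::cstar_algebra \<Rightarrow> _) = UNIV \<longleftrightarrow> unital_cstar TYPE('a)"
proof
  assume "range (emb :: 'a \<Rightarrow> _) = UNIV"
  then have "(1 :: 'a unitization) \<in> range emb" by simp
  then obtain e :: 'a where e: "1 = emb e" by auto
  have "e * x = x" for x using act_simps(7)[of e x] by (simp add: e[symmetric])
  moreover have "x * e = x" for x
  proof (rule injD[OF inj_emb])
    show "emb (x * e) = emb x" by (simp add: emb_mult e[symmetric])
  qed
  ultimately show "unital_cstar TYPE('a)" by (auto simp: unital_cstar_def)
next
  assume "unital_cstar TYPE('a)"
  then obtain e :: 'a where e: "\<And>x. e * x = x" by (auto simp: unital_cstar_def)
  have "u = emb (act u e)" for u
    by (rule unitization_eqI) (simp add: act_mult[symmetric] e)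
  then show "range (emb :: 'a \<Rightarrow> _) = UNIV" by auto
qed


section \<open>Invertible groups and commutators\<close>

text \<open>
  The subalgebra \<open>I\<^sup>\<sim>\<close> of \<open>A\<^sup>\<sim>\<close> always contains the unit of \<open>A\<^sup>\<sim>\<close>, also when the ideal \<open>I\<close> has a unit
  \<open>e\<close> of its own; an invertible \<open>u\<close> of \<open>I\<close> then corresponds to \<open>1 + (u - e)\<close>.
\<close>

definition unitization_of :: "'a::cstar_algebra set \<Rightarrow> 'a unitization set"
  where "unitization_of I = {c *\<^sub>C 1 + emb x |c x. x \<in> I}"

text \<open>
  The whole algebra is \<open>I = UNIV\<close>.  In that case a unital algebra needs no separate clause, as
  every element of \<open>A\<^sup>\<sim> = A\<close> then has the form \<open>1 + x\<close> with \<open>x \<in> A\<close> (lemma \<open>GL_unital\<close>).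
\<close>

definition GL :: "'a::cstar_algebra set \<Rightarrow> 'a unitization set"
  where "GL I = {u. (\<exists>x\<in>I. u = 1 + emb x) \<and> (\<exists>v\<in>unitization_of I. u * v = 1 \<and> v * u = 1)}"

lemma GL_unital:
  assumes "unital_cstar TYPE('a::cstar_algebra)"
  shows "GL (UNIV :: 'a set) = {u. \<exists>v. u * v = 1 \<and> v * u = 1}"
proof -
  have 1: "\<exists>x. u = 1 + emb x" for u :: "'a unitization"
  proof -
    have "u - 1 \<in> range emb" using assms range_emb_iff_unital[where 'a='a] by simp
    then obtain x where "u - 1 = emb x" by blast
    then have "u = 1 + emb x" by (simp add: algebra_simps)
    then show ?thesis ..
  qed
  have 2: "u \<in> unitization_of UNIV" for u :: "'a unitization"
    using unitization_form[of u] unfolding unitization_of_def by blast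
  show ?thesis unfolding GL_def using 1 2 by (intro Collect_cong) blast
qed

definition G_of :: "'a::cstar_algebra set \<Rightarrow> 'a unitization monoid"
  where "G_of I = \<lparr>carrier = connected_component_set (GL I) 1, monoid.mult = (*), one = 1\<rparr>"

lemma emb_add: "emb (x + y) = emb x + emb y"
  by (rule linear_add[OF bounded_linear.linear[OF bounded_linear_emb]])

lemma unitization_of_mult:
  assumes I: "closed_ideal I" and u: "u \<in> unitization_of I" and v: "v \<in> unitization_of I"
  shows "u * v \<in> unitization_of I"
proof -
  obtain c x d y where x: "x \<in> I" and u: "u = c *\<^sub>C 1 + emb x"
    and y: "y \<in> I" and v: "v = d *\<^sub>C 1 + emb y"
    using u v by (auto simp: unitization_of_def)
  have "u * v = (c * d) *\<^sub>C 1 + emb (c *\<^sub>C y + d *\<^sub>C x + x * y)"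
    by (simp add: u v emb_add emb_scaleC emb_mult distrib_left distrib_right mult_scaleC_left
        mult_scaleC_right scaleC_add_right scaleC_scaleC)
  moreover have "c *\<^sub>C y + d *\<^sub>C x + x * y \<in> I"
    using I x y by (auto simp: closed_ideal_def complex_vector.subspace_def)
  ultimately show ?thesis unfolding unitization_of_def by blast
qed

lemma emb_mult_unitization_of:
  assumes I: "closed_ideal I" and x: "x \<in> I" and v: "v \<in> unitization_of I"
  shows "\<exists>y\<in>I. emb x * v = emb y"
proof -
  obtain c z where z: "z \<in> I" and v: "v = c *\<^sub>C 1 + emb z"
    using v by (auto simp: unitization_of_def)
  have "emb x * v = emb (c *\<^sub>C x + x * z)"
    by (simp add: v emb_add emb_scaleC emb_mult distrib_left mult_scaleC_right)
  moreover have "c *\<^sub>C x + x * z \<in> I"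
    using I x z by (auto simp: closed_ideal_def complex_vector.subspace_def)
  ultimately show ?thesis by blast
qed

lemma GL_subset_unitization_of: "GL I \<subseteq> unitization_of I"
  by (force simp: GL_def unitization_of_def scaleC_one intro: exI[of _ 1])

lemma one_in_GL: "closed_ideal (I :: 'a::cstar_algebra set) \<Longrightarrow> 1 \<in> GL I"
proof -
  assume "closed_ideal I"
  then have "0 \<in> I" by (simp add: closed_ideal_def complex_vector.subspace_def)
  moreover have one: "1 = 1 + emb 0"
    by (simp add: linear_0[OF bounded_linear.linear[OF bounded_linear_emb]])
  moreover have "1 = 1 *\<^sub>C 1 + emb 0" using one by (simp add: scaleC_one)
  ultimately have "1 \<in> unitization_of I" "\<exists>x\<in>I. 1 = 1 + emb x"
    unfolding unitization_of_def by blast+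
  moreover have "(1 :: 'a unitization) * 1 = 1" by simp
  ultimately show "1 \<in> GL I" unfolding GL_def by blast
qed

lemma GL_mult:
  assumes I: "closed_ideal I" and u: "u \<in> GL I" and v: "v \<in> GL I"
  shows "u * v \<in> GL I"
proof -
  obtain x u' where x: "x \<in> I" "u = 1 + emb x" and u': "u' \<in> unitization_of I" "u * u' = 1" "u' * u = 1"
    using u by (auto simp: GL_def)
  obtain y v' where y: "y \<in> I" "v = 1 + emb y" and v': "v' \<in> unitization_of I" "v * v' = 1" "v' * v = 1"
    using v by (auto simp: GL_def)
  have "v \<in> unitization_of I" using v GL_subset_unitization_of by blast
  then obtain z where z: "z \<in> I" "emb x * v = emb z"
    using emb_mult_unitization_of[OF I x(1)] by blast
  have "u * v = 1 + emb (y + z)"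
    by (simp add: x(2) distrib_right z emb_add) (simp add: y(2) algebra_simps)
  moreover have "y + z \<in> I"
    using I y z by (auto simp: closed_ideal_def complex_vector.subspace_def)
  moreover have "(u * v) * (v' * u') = u * (v * v') * u'" "(v' * u') * (u * v) = v' * (u' * u) * v"
    by (simp_all add: mult.assoc)
  then have "(u * v) * (v' * u') = 1" "(v' * u') * (u * v) = 1" by (simp_all add: u' v')
  ultimately show ?thesis
    using unitization_of_mult[OF I v'(1) u'(1)] unfolding GL_def by blast
qed

lemma GL_inverse:
  assumes I: "closed_ideal I" and u: "u \<in> GL I"
  obtains v where "v \<in> GL I" "u * v = 1" "v * u = 1"
proof -
  obtain x v where x: "x \<in> I" "u = 1 + emb x" and v: "v \<in> unitization_of I" "u * v = 1" "v * u = 1"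
    using u by (auto simp: GL_def)
  obtain z where z: "z \<in> I" "emb x * v = emb z"
    using emb_mult_unitization_of[OF I x(1) v(1)] by blast
  have "v + emb z = 1" using v(2) by (simp add: x(2) distrib_right z)
  then have "v = 1 + emb (- z)"
    by (simp add: linear_neg[OF bounded_linear.linear[OF bounded_linear_emb]] eq_diff_eq)
  moreover have "- z \<in> I"
    using I z complex_vector.subspace_neg unfolding closed_ideal_def by blast
  moreover have "u \<in> unitization_of I" using u GL_subset_unitization_of by blast
  ultimately have "v \<in> GL I" using v unfolding GL_def by blast
  then show ?thesis using v that by blast
qed

lemma connected_component_GL_mult:
  assumes I: "closed_ideal I" and u: "u \<in> GL I" and S: "S \<subseteq> GL I" "connected S"
    and one: "1 \<in> (*) u ` S" and v: "v \<in> S"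
  shows "u * v \<in> connected_component_set (GL I) 1"
proof -
  have "connected ((*) u ` S)"
    using S(2) by (intro connected_continuous_image continuous_intros)
  moreover have "(*) u ` S \<subseteq> GL I" using GL_mult[OF I u] S by blast
  ultimately show ?thesis
    using one v by (auto simp: connected_component_def)
qed

lemma group_G_of:
  assumes I: "closed_ideal I"
  shows "group (G_of I)"
proof -
  let ?C = "connected_component_set (GL I) 1"
  have C: "?C \<subseteq> GL I" "connected ?C" "1 \<in> ?C"
    using one_in_GL[OF I] by (simp_all add: connected_component_subset)
  have mult: "u * v \<in> ?C" if "u \<in> ?C" "v \<in> ?C" for u v
  proof -
    have "u \<in> GL I" using that(1) C(1) by blast
    have "connected ((*) u ` ?C)"
      using C(2) by (intro connected_continuous_image continuous_intros)
    moreover have "(*) u ` ?C \<subseteq> GL I" using GL_mult[OF I \<open>u \<in> GL I\<close>] C(1) by blast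
    moreover have "u \<in> (*) u ` ?C" "u * v \<in> (*) u ` ?C"
      using C(3) that(2) image_eqI[of u "(*) u" 1 ?C] by auto
    ultimately have "connected_component (GL I) u (u * v)"
      unfolding connected_component_def by blast
    then show ?thesis using that(1) connected_component_trans by blast
  qed
  have inverse: "\<exists>v\<in>?C. v * u = 1" if "u \<in> ?C" for u
  proof -
    have "u \<in> GL I" using that C(1) by blast
    then obtain v where v: "v \<in> GL I" "u * v = 1" "v * u = 1" by (rule GL_inverse[OF I])
    have "1 \<in> (*) v ` ?C" using that v(3) by (metis imageI)
    from connected_component_GL_mult[OF I v(1) C(1,2) this C(3)] v(3)
    show ?thesis by auto
  qed
  show ?thesis
    by (rule groupI) (use mult inverse C(3) in \<open>simp_all add: G_of_def mult.assoc\<close>)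
qed

definition lie_bracket :: "'a::cstar_algebra set \<Rightarrow> 'a set \<Rightarrow> 'a set"
  where "lie_bracket X Y = complex_vector.span {x * y - y * x |x y. x \<in> X \<and> y \<in> Y}"

definition commutator_subgroup :: "('g, 'b) monoid_scheme \<Rightarrow> 'g set \<Rightarrow> 'g set \<Rightarrow> 'g set"
  where "commutator_subgroup K X Y =
    generate K {x \<otimes>\<^bsub>K\<^esub> y \<otimes>\<^bsub>K\<^esub> inv\<^bsub>K\<^esub> x \<otimes>\<^bsub>K\<^esub> inv\<^bsub>K\<^esub> y |x y. x \<in> X \<and> y \<in> Y}"

text \<open>
  Closures of subgroups are taken in the topological group, which is in general not closed in the
  algebra.  For comparing subsets this makes no difference.
\<close>

lemma closure_of_eq_iff:
  assumes "X \<subseteq> S" "Y \<subseteq> S"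
  shows "top_of_set S closure_of X = top_of_set S closure_of Y \<longleftrightarrow> closure X = closure Y"
proof -
  have eq: "top_of_set S closure_of Z = S \<inter> closure Z" if "Z \<subseteq> S" for Z
    using that by (simp add: closure_of_subtopology Int_absorb1)
  have "closure X = closure Y" if "S \<inter> closure X = S \<inter> closure Y"
  proof -
    have "X \<subseteq> closure Y" "Y \<subseteq> closure X"
      using that assms closure_subset[of X] closure_subset[of Y] by blast+
    then show ?thesis by (simp add: closure_minimal subset_antisym)
  qed
  then show ?thesis using eq assms by auto
qed

end

theory Submission
  imports Defs
begin

text \<open>
  The proof is an infinitesimal one.  A subgroup \<open>K\<close> of the connected group \<open>GA\<close> of invertibles has a set
  \<open>tangent K\<close> of tangent vectors at \<open>1\<close>; for normal \<open>K\<close> it is a closed real subspace, and \<open>[x, A]\<close> stays in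
  it for each of its elements \<open>x\<close>.  Group commutators and Lie brackets determine each other: if \<open>S\<close> is a
  closed ideal and \<open>g \<in> GA\<close>, and all commutators \<open>(g, v)\<close> with \<open>v\<close> in the group of \<open>S\<close> lie in \<open>K\<close>, then
  \<open>[g, S]\<close> is tangent to \<open>K\<close> (\<open>tangent_of_commutators\<close>, by differentiation).  Conversely, if \<open>[g, S]\<close> is
  tangent to the normal subgroup \<open>K\<close>, then all these commutators lie in the closure of \<open>K\<close>
  (\<open>commutators_of_tangent\<close>, by integration along \<open>t \<mapsto> (g, 1 + t x)\<close>).  The theorem is thereby reduced to
  two statements about Lie brackets.

  For the subgroup \<open>X\<close> generated by \<open>(H, GA)\<close>, the brackets \<open>[H, A]\<close> are tangent to \<open>X\<close>, and \<open>[I, A]\<close> is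
  needed for the ideal \<open>I\<close> generated by \<open>[H, A]\<close>.  This is a statement about Lie ideals in the style of
  Herstein (\<open>Lie_ideal_contains_commutators_of_ideal\<close>), which rests on closed ideals of C*-algebras
  being semiprime.

  For the subgroup \<open>Y\<close> generated by the commutators of the group of \<open>I\<close> with \<open>GA\<close>, the brackets \<open>[h, I]\<close>
  are tangent to \<open>Y\<close>, and \<open>[h, A]\<close> is needed for \<open>h \<in> H\<close>.  Since \<open>[h, A] \<subseteq> I\<close>, an approximate unit of \<open>I\<close> that
  almost commutes with \<open>h\<close> shows that \<open>[h, A]\<close> lies in the closure of \<open>[h, I]\<close>
  (\<open>commutators_in_ideal_approximable\<close>).

  Both facts on C*-algebras are obtained from a single elementary construction, the contractive
  resolvents of skew-adjoint elements (\<open>square_annihilating_contraction\<close>), in place of spectral theory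
  and functional calculus.
\<close>


section \<open>Inverses near the identity\<close>

text \<open>
  A right inverse \<open>v\<close> of \<open>1 - x\<close> is a fixed point of the contraction \<open>v \<mapsto> 1 + x v\<close>, and a left inverse is
  one of \<open>v \<mapsto> 1 + v x\<close>, so Banach's fixed point theorem replaces the geometric series.
\<close>

lemma Neumann_inverse:
  fixes x :: "'b::{real_normed_algebra, complete_space, monoid_mult}"
  assumes "norm x < 1"
  obtains v where "(1 - x) * v = 1" "v * (1 - x) = 1"
proof -
  have "\<exists>!v. 1 + x * v = v"
  proof (rule banach_fix_type[of "norm x"])
    show "\<forall>v w. dist (1 + x * v) (1 + x * w) \<le> norm x * dist v w"
      by (simp add: dist_norm right_diff_distrib[symmetric] norm_mult_ineq)
  qed (use assms in auto)
  then obtain v where v: "1 + x * v = v" by blast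
  have "\<exists>!w. 1 + w * x = w"
  proof (rule banach_fix_type[of "norm x"])
    show "\<forall>v w. dist (1 + v * x) (1 + w * x) \<le> norm x * dist v w"
      by (metis add_diff_cancel_left dist_norm left_diff_distrib mult.commute norm_mult_ineq)
  qed (use assms in auto)
  then obtain w where w: "1 + w * x = w" by blast
  have r: "(1 - x) * v = 1" using v by (simp add: left_diff_distrib) (metis add_diff_cancel_right')
  have l: "w * (1 - x) = 1" using w by (simp add: right_diff_distrib) (metis add_diff_cancel_right')
  have "w = w * ((1 - x) * v)" by (simp add: r)
  also have "\<dots> = v" by (simp add: mult.assoc[symmetric] l)
  finally show ?thesis using r l that by blast
qed

lemma norm_inverse_le_2:
  fixes x v :: "'b::{real_normed_algebra, monoid_mult}"
  assumes "(1 + x) * v = 1" "norm x \<le> 1 / 2" "norm (1 :: 'b) \<le> 1"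
  shows "norm v \<le> 2"
proof -
  have "v = 1 - x * v" using assms(1) by (simp add: algebra_simps eq_diff_eq)
  then have "norm v \<le> norm (1 :: 'b) + norm (x * v)" by (metis norm_triangle_ineq4)
  also have "\<dots> \<le> 1 + 1 / 2 * norm v"
    using assms by (intro add_mono order_trans[OF norm_mult_ineq] mult_right_mono) auto
  finally show ?thesis by simp
qed


section \<open>Contractions from skew-adjoint elements\<close>

lemma star_1: "star 1 = (1 :: 'b::{cstar_algebra, monoid_mult})"
  by (metis mult_1_right star_mult star_star)

lemma norm_1_le: "norm (1 :: 'b::{cstar_algebra, monoid_mult}) \<le> 1"
  using cstar_identity[of "1 :: 'b"] by (auto simp: star_1 power2_eq_square)

lemma star_0 [simp]: "star (0 :: 'b::cstar_algebra) = 0"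
  by (metis add_cancel_right_right star_add)

lemma star_minus: "star (- x) = - star (x :: 'b::cstar_algebra)"
  by (metis add.right_inverse add_eq_0_iff star_0 star_add)

lemma star_diff: "star (x - y) = star x - star (y :: 'b::cstar_algebra)"
  by (metis diff_conv_add_uminus star_add star_minus)

lemma star_scaleR: "star (r *\<^sub>R x) = r *\<^sub>R star (x :: 'b::cstar_algebra)"
  by (simp add: scaleC_of_real[symmetric] star_scaleC)

text \<open>
  The Cayley transform \<open>c = (1 + j) (1 - j)\<^sup>-\<^sup>1\<close> of a skew-adjoint element satisfies \<open>star c * c = 1\<close>, so
  it is a contraction, and the resolvent \<open>w\<close> is the mean of \<open>1\<close> and \<open>c\<close>.
\<close>

lemma norm_skew_resolvent_le:
  fixes j w :: "'b::{cstar_algebra, monoid_mult}"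
  assumes skew: "star j = - j" and w: "(1 - j) * w = 1" "w * (1 - j) = 1"
  shows "norm w \<le> 1"
proof -
  define c where "c = (1 + j) * w"
  have sw: "star w * (1 + j) = 1"
    using arg_cong[OF w(1), of star] by (simp add: star_mult star_diff star_1 skew)
  have "star c = star w * (1 - j)" by (simp add: c_def star_mult star_add star_1 skew)
  then have "star c * c = star w * ((1 - j) * (1 + j)) * w" by (simp add: c_def mult.assoc)
  also have "(1 - j) * (1 + j) = (1 + j) * (1 - j)" by (simp add: algebra_simps)
  also have "star w * ((1 + j) * (1 - j)) * w = (star w * (1 + j)) * ((1 - j) * w)"
    by (simp add: mult.assoc)
  also have "\<dots> = 1" by (simp add: sw w)
  finally have "(norm c)\<^sup>2 \<le> 1\<^sup>2" using cstar_identity[of c] norm_1_le[where 'b='b] by simp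
  then have c: "norm c \<le> 1" by (rule power2_le_imp_le) simp
  have "1 + c = (1 - j) * w + (1 + j) * w" by (simp add: c_def w)
  also have "\<dots> = w + w" by (simp add: algebra_simps)
  also have "\<dots> = 2 *\<^sub>R w" by (simp add: scaleR_2)
  finally have "2 * norm w = norm (1 + c)" by simp
  also have "\<dots> \<le> 1 + 1" using c norm_1_le[where 'b='b] by (intro order_trans[OF norm_triangle_ineq]) auto
  finally show ?thesis by simp
qed

text \<open>
  Invertibility is propagated from \<open>1\<close> to \<open>1 - j\<close> in steps of size \<open>j / N\<close>.  Since the resolvents met on
  the way are contractions, a step of norm less than \<open>1\<close> always stays within reach of the Neumann
  inverse.  This is the only spectral information used: self-adjoint elements have real spectrum.
\<close>

lemma skew_resolvent:
  fixes j :: "'b::{cstar_algebra, monoid_mult}"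
  assumes skew: "star j = - j"
  obtains w where "(1 - j) * w = 1" "w * (1 - j) = 1" "norm w \<le> 1"
proof -
  obtain N :: nat where N: "norm j < real N" "N > 0"
    by (metis gr0I not_less_zero of_nat_0_less_iff reals_Archimedean2 norm_ge_zero order_le_less_trans)
  define j0 where "j0 = (1 / real N) *\<^sub>R j"
  have j0: "norm j0 < 1" "star j0 = - j0" "j = real N *\<^sub>R j0"
    using N by (simp_all add: j0_def star_scaleR skew)
  have "\<exists>w. (1 - real n *\<^sub>R j0) * w = 1 \<and> w * (1 - real n *\<^sub>R j0) = 1" for n
  proof (induction n)
    case 0
    show ?case by (intro exI[of _ 1]) simp
  next
    case (Suc n)
    define j1 where "j1 = real n *\<^sub>R j0"
    obtain w where w: "(1 - j1) * w = 1" "w * (1 - j1) = 1" using Suc by (auto simp: j1_def)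
    have "norm w \<le> 1"
      by (rule norm_skew_resolvent_le[OF _ w]) (simp add: j1_def star_scaleR j0)
    then have "norm j0 * norm w \<le> norm j0 * 1" by (intro mult_left_mono) auto
    with norm_mult_ineq[of j0 w] j0(1) have "norm (j0 * w) < 1" by simp
    then obtain v where v: "(1 - j0 * w) * v = 1" "v * (1 - j0 * w) = 1" by (rule Neumann_inverse)
    have comm: "j1 * j0 = j0 * j1" by (simp add: j1_def)
    have "w * j0 * (1 - j1) = w * (1 - j1) * j0" using comm by (simp add: algebra_simps)
    then have "w * j0 * (1 - j1) * w = j0 * w" by (simp add: w)
    then have wj: "w * j0 = j0 * w" by (simp add: w mult.assoc)
    have S: "1 - real (Suc n) *\<^sub>R j0 = 1 - j1 - j0" by (simp add: j1_def algebra_simps)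
    have "(1 - j1) * (1 - j0 * w) = 1 - j1 - (1 - j1) * w * j0"
      by (simp add: right_diff_distrib wj[symmetric] mult.assoc)
    then have e1: "1 - real (Suc n) *\<^sub>R j0 = (1 - j1) * (1 - j0 * w)" by (simp only: w S mult_1_left)
    have "(1 - j0 * w) * (1 - j1) = 1 - j1 - j0 * (w * (1 - j1))"
      by (simp add: left_diff_distrib mult.assoc)
    then have e2: "1 - real (Suc n) *\<^sub>R j0 = (1 - j0 * w) * (1 - j1)" by (simp only: w S mult_1_right)
    have "(1 - real (Suc n) *\<^sub>R j0) * (w * v) = 1"
      unfolding e2 by (simp add: mult.assoc[symmetric]) (simp add: mult.assoc w v)
    moreover have "(v * w) * (1 - real (Suc n) *\<^sub>R j0) = 1"
      unfolding e1 by (metis mult.assoc mult_1_left w(2) v(2))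
    moreover have "v * w = w * v"
      by (metis calculation mult.assoc mult_1_left mult_1_right)
    ultimately show ?case by metis
  qed
  from this[of N] obtain w where w: "(1 - j) * w = 1" "w * (1 - j) = 1" by (auto simp: j0)
  with norm_skew_resolvent_le[OF skew w] that show ?thesis by blast
qed

text \<open>
  This is the substitute for continuous functional calculus.  With \<open>b = star x * x\<close>, the resolvent
  \<open>w = (1 - i n b)\<^sup>-\<^sup>1\<close> plays the role of a function which is \<open>1\<close> at \<open>0\<close> and small elsewhere on the
  spectrum of \<open>b\<close>: the identity \<open>i n b w = w - 1\<close> gives both \<open>norm (b w) \<le> 2 / n\<close> and the divisibility of
  \<open>1 - w\<close> by \<open>b\<close>, which puts \<open>1 - w\<close> into every ideal that contains \<open>b\<close>.
\<close>

lemma square_annihilating_contraction: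
  fixes x :: "'b::{cstar_algebra, monoid_mult}"
  assumes "\<epsilon> > 0"
  obtains w y z where "norm w \<le> 1" "1 - w = star x * x * y" "star (1 - w) = star x * x * z"
    "norm (x * w) \<le> \<epsilon>"
proof -
  define b where "b = star x * x"
  have b: "star b = b" by (simp add: b_def star_mult star_star)
  obtain n :: nat where n: "real n > 2 / \<epsilon>\<^sup>2" using reals_Archimedean2 by blast
  have "2 / \<epsilon>\<^sup>2 > 0" using assms by simp
  with n have n0: "real n > 0" by linarith
  define c where "c = \<i> * complex_of_real (real n)"
  define j where "j = c *\<^sub>C b"
  have "star j = - j" by (simp add: j_def star_scaleC b c_def complex_vector.scale_minus_left)
  then obtain w where w: "(1 - j) * w = 1" "w * (1 - j) = 1" "norm w \<le> 1" by (rule skew_resolvent)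
  have jw: "j * w = w - 1" using w(1) by (simp add: left_diff_distrib) (metis add_diff_cancel_left' diff_add_cancel minus_diff_eq)
  have sw: "star w * (1 + j) = 1" "(1 + j) * star w = 1"
    using arg_cong[OF w(1), of star] arg_cong[OF w(2), of star] \<open>star j = - j\<close>
    by (simp_all add: star_mult star_diff star_1)
  have e1: "1 - w = b * ((- c) *\<^sub>C w)"
    using jw by (simp add: j_def mult_scaleC_left mult_scaleC_right complex_vector.scale_minus_left)
  have "star (1 - w) = j * star w"
    using sw(2) by (simp add: star_diff star_1 distrib_right) (metis add_diff_cancel_left')
  then have e2: "star (1 - w) = b * (c *\<^sub>C star w)"
    by (simp add: j_def mult_scaleC_left mult_scaleC_right)
  have "norm (j * w) = real n * norm (b * w)"
    by (simp add: j_def c_def mult_scaleC_left norm_scaleC norm_mult)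
  moreover have "norm (j * w) \<le> 2"
    using norm_triangle_ineq4[of w 1] w(3) norm_1_le[where 'b='b] by (simp add: jw)
  ultimately have bw: "norm (b * w) \<le> 2 / real n" using n0 by (simp add: field_simps)
  have "(norm (x * w))\<^sup>2 = norm (star w * (b * w))"
    by (simp add: cstar_identity[symmetric] star_mult b_def mult.assoc)
  also have "\<dots> \<le> norm w * norm (b * w)" by (metis norm_mult_ineq norm_star)
  also have "\<dots> \<le> 1 * (2 / real n)" using w(3) bw by (intro mult_mono) auto
  also have "\<dots> \<le> \<epsilon>\<^sup>2" using n n0 assms by (simp add: field_simps)
  finally have "norm (x * w) \<le> \<epsilon>" using assms by (rule power2_le_imp_le[OF _ less_imp_le])
  with w(3) e1 e2 show ?thesis unfolding b_def by (rule that)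
qed


section \<open>Closed ideals\<close>

lemma closed_ideal_closed: "closed_ideal J \<Longrightarrow> closed J"
  and closed_ideal_zero: "closed_ideal J \<Longrightarrow> 0 \<in> J"
  and closed_ideal_add: "closed_ideal J \<Longrightarrow> x \<in> J \<Longrightarrow> y \<in> J \<Longrightarrow> x + y \<in> J"
  and closed_ideal_diff: "closed_ideal J \<Longrightarrow> x \<in> J \<Longrightarrow> y \<in> J \<Longrightarrow> x - y \<in> J"
  and closed_ideal_minus: "closed_ideal J \<Longrightarrow> x \<in> J \<Longrightarrow> - x \<in> J"
  and closed_ideal_scaleC: "closed_ideal J \<Longrightarrow> x \<in> J \<Longrightarrow> c *\<^sub>C x \<in> J"
  and closed_ideal_mult_left: "closed_ideal J \<Longrightarrow> x \<in> J \<Longrightarrow> a * x \<in> J"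
  and closed_ideal_mult_right: "closed_ideal J \<Longrightarrow> x \<in> J \<Longrightarrow> x * a \<in> J"
  unfolding closed_ideal_def
  by (auto intro: complex_vector.subspace_0 complex_vector.subspace_add
      complex_vector.subspace_diff complex_vector.subspace_neg complex_vector.subspace_scale)

lemma closed_ideal_scaleR: "closed_ideal J \<Longrightarrow> x \<in> J \<Longrightarrow> r *\<^sub>R x \<in> J"
  using closed_ideal_scaleC[of J x "of_real r"] by (simp add: scaleC_of_real)

text \<open>
  A closed ideal of \<open>A\<close> remains one in the unitization, so statements about closed ideals of unital
  algebras apply to the ideals of \<open>A\<close>.  The image is closed because \<open>emb\<close> is an isometry.
\<close>

lemma closed_ideal_emb:
  fixes J :: "'a::cstar_algebra set"
  assumes J: "closed_ideal J"
  shows "closed_ideal (emb ` J)"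
  unfolding closed_ideal_def
proof (intro conjI allI ballI)
  have "complete (emb ` J)"
    by (rule complete_isometric_image[where e = 1])
      (use J in \<open>auto simp: bounded_linear_emb norm_emb complete_eq_closed real_vector.subspace_def
         intro: closed_ideal_zero closed_ideal_add closed_ideal_scaleR closed_ideal_closed\<close>)
  then show "closed (emb ` J)" by (rule complete_imp_closed)
  show "complex_vector.subspace (emb ` J)"
  proof (rule complex_vector.subspaceI)
    show "0 \<in> emb ` J"
      using closed_ideal_zero[OF J] bounded_linear.linear[OF bounded_linear_emb]
      by (metis image_eqI linear_0)
  qed (use J in \<open>auto simp: emb_add[symmetric] emb_scaleC[symmetric]
         intro: closed_ideal_add closed_ideal_scaleC\<close>)
  fix u x :: "'a unitization" assume "x \<in> emb ` J"
  then obtain y where y: "y \<in> J" "x = emb y" by blast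
  obtain c a where u: "u = c *\<^sub>C 1 + emb a" by (rule unitization_form)
  have "u * x = emb (c *\<^sub>C y + a * y)" "x * u = emb (c *\<^sub>C y + y * a)"
    by (simp_all add: u y emb_add emb_scaleC emb_mult distrib_left distrib_right
        mult_scaleC_left mult_scaleC_right)
  moreover have "c *\<^sub>C y + a * y \<in> J" "c *\<^sub>C y + y * a \<in> J"
    by (auto intro!: closed_ideal_add[OF J closed_ideal_scaleC[OF J y(1)]]
        closed_ideal_mult_left[OF J y(1)] closed_ideal_mult_right[OF J y(1)])
  ultimately show "u * x \<in> emb ` J" "x * u \<in> emb ` J" by (metis imageI)+
qed

text \<open>
  For \<open>b = star x * x\<close> the hypothesis puts \<open>b\<^sup>2\<close> into \<open>J\<close>.  A contraction \<open>w\<close> which nearly annihilates \<open>b\<close> and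
  is \<open>1\<close> modulo \<open>b\<^sup>2\<close> also nearly annihilates \<open>x\<close>, by the C*-identity, and so \<open>x\<close> is close to
  \<open>x (1 - w) \<in> J\<close>.
\<close>

lemma closed_ideal_semiprime_unital:
  fixes x :: "'b::{cstar_algebra, monoid_mult}"
  assumes J: "closed_ideal J" and x: "x * star x * x \<in> J"
  shows "x \<in> J"
proof -
  define b where "b = star x * x"
  have b: "star b = b" by (simp add: b_def star_mult star_star)
  have "b * b = star x * (x * star x * x)" by (simp add: b_def mult.assoc)
  then have bb: "star b * b \<in> J" using closed_ideal_mult_left[OF J x] by (simp add: b)
  have "x \<in> closure J"
    unfolding closure_approachable
  proof (intro allI impI)
    fix e :: real assume "e > 0"
    then have "(e / 2)\<^sup>2 > 0" by simp
    then obtain w y where w: "norm w \<le> 1" "1 - w = star b * b * y" "norm (b * w) \<le> (e / 2)\<^sup>2"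
      by (rule square_annihilating_contraction[of _ b])
    have "1 - w \<in> J" unfolding w(2) by (rule closed_ideal_mult_right[OF J bb])
    moreover have "(norm (x * w))\<^sup>2 \<le> (e / 2)\<^sup>2"
    proof -
      have "(norm (x * w))\<^sup>2 = norm (star w * (b * w))"
        by (simp add: cstar_identity[symmetric] star_mult b_def mult.assoc)
      also have "\<dots> \<le> norm w * norm (b * w)" by (metis norm_mult_ineq norm_star)
      also have "\<dots> \<le> 1 * (e / 2)\<^sup>2" using w by (intro mult_mono) auto
      finally show ?thesis by simp
    qed
    then have "norm (x * w) \<le> e / 2" by (rule power2_le_imp_le) (use \<open>e > 0\<close> in simp)
    then have "dist (x * (1 - w)) x < e"
      using \<open>e > 0\<close> by (simp add: dist_norm right_diff_distrib)
    ultimately show "\<exists>y\<in>J. dist y x < e" using closed_ideal_mult_left[OF J] by blast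
  qed
  then show ?thesis using closed_ideal_closed[OF J] by simp
qed

lemma closed_ideal_semiprime:
  fixes x :: "'a::cstar_algebra"
  assumes J: "closed_ideal J" and x: "x * star x * x \<in> J"
  shows "x \<in> J"
proof -
  have "emb x * star (emb x) * emb x \<in> emb ` J" using x by (simp add: star_emb emb_mult[symmetric])
  then have "emb x \<in> emb ` J" by (rule closed_ideal_semiprime_unital[OF closed_ideal_emb[OF J]])
  then show ?thesis by (auto dest: injD[OF inj_emb])
qed

text \<open>
  The elements of \<open>F\<close> are treated one after the other: if \<open>w\<close> nearly annihilates \<open>x (1 - e)\<close>, replace
  \<open>1 - e\<close> by \<open>(1 - e) w\<close>.  As \<open>w\<close> is a contraction, this preserves the estimates for the earlier
  elements.  The adjoint of \<open>e\<close> will serve as an element of \<open>S\<close> as well, so \<open>star e \<in> S\<close> is part of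
  the claim.
\<close>

lemma approximate_unit:
  fixes S :: "'b::{cstar_algebra, monoid_mult} set"
  assumes S: "closed_ideal S" and "finite F" "F \<subseteq> S" and "\<epsilon> > 0"
  shows "\<exists>e\<in>S. star e \<in> S \<and> norm (1 - e) \<le> 1 \<and> (\<forall>y\<in>F. norm (y - y * e) \<le> \<epsilon>)"
  using assms(2,3)
proof induction
  case empty
  show ?case
    using closed_ideal_zero[OF S] norm_1_le[where 'b='b] by (intro bexI[of _ 0]) simp_all
next
  case (insert x F)
  then obtain e where e: "e \<in> S" "star e \<in> S" "norm (1 - e) \<le> 1"
    "\<And>y. y \<in> F \<Longrightarrow> norm (y - y * e) \<le> \<epsilon>" by auto
  obtain w y z where w: "norm w \<le> 1"
    "1 - w = star (x * (1 - e)) * (x * (1 - e)) * y"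
    "star (1 - w) = star (x * (1 - e)) * (x * (1 - e)) * z"
    "norm (x * (1 - e) * w) \<le> \<epsilon>"
    by (rule square_annihilating_contraction[OF \<open>\<epsilon> > 0\<close>])
  have "star (x * (1 - e)) * (x * (1 - e)) \<in> S"
    using insert.prems by (intro closed_ideal_mult_left[OF S] closed_ideal_mult_right[OF S]) auto
  then have wS: "1 - w \<in> S" "star (1 - w) \<in> S"
    by (metis w(2) closed_ideal_mult_right[OF S], metis w(3) closed_ideal_mult_right[OF S])
  define f where "f = e + (1 - e) * (1 - w)"
  have f: "1 - f = (1 - e) * w" by (simp add: f_def right_diff_distrib left_diff_distrib)
  have "f \<in> S" unfolding f_def using e wS by (intro closed_ideal_add[OF S] closed_ideal_mult_left[OF S])
  moreover have "star f \<in> S"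
    unfolding f_def star_add star_mult using e wS
    by (intro closed_ideal_add[OF S] closed_ideal_mult_right[OF S])
  moreover have "norm (1 - f) \<le> 1"
    unfolding f using mult_mono[OF e(3) w(1)] norm_mult_ineq[of "1 - e" w] by simp
  moreover have "norm (y - y * f) \<le> \<epsilon>" if "y \<in> insert x F" for y
  proof -
    have yf: "y - y * f = y * (1 - e) * w"
      using arg_cong[OF f, of "(*) y"] by (simp only: right_diff_distrib mult.assoc[symmetric] mult_1_right)
    show ?thesis
    proof (cases "y = x")
      case True
      then show ?thesis using w(4) unfolding yf by simp
    next
      case False
      then have "norm (y * (1 - e)) \<le> \<epsilon>" using e(4) that by (simp add: right_diff_distrib)
      then have "norm (y * (1 - e)) * norm w \<le> \<epsilon> * 1" using w(1) \<open>\<epsilon> > 0\<close> by (intro mult_mono) auto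
      then show ?thesis unfolding yf using norm_mult_ineq[of "y * (1 - e)" w] by simp
    qed
  qed
  ultimately show ?case by blast
qed

lemma norm_sum_almost_orthogonal:
  fixes c d :: "'b::cstar_algebra"
  assumes "norm (star c * d) \<le> 1 / 2"
  shows "(norm (c + d))\<^sup>2 \<le> (norm c)\<^sup>2 + (norm d)\<^sup>2 + 1"
proof -
  have "norm (star d * c) = norm (star c * d)" using norm_star[of "star c * d"] by (simp add: star_mult star_star)
  have "(norm (c + d))\<^sup>2 = norm ((star c * c + star d * d) + (star c * d + star d * c))"
    unfolding cstar_identity[symmetric] by (simp add: star_add algebra_simps)
  also have "\<dots> \<le> (norm (star c * c) + norm (star d * d)) + (norm (star c * d) + norm (star d * c))"
    by (intro order_trans[OF norm_triangle_ineq] add_mono norm_triangle_ineq)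
  finally show ?thesis using assms \<open>norm (star d * c) = _\<close> by (simp add: cstar_identity)
qed

text \<open>
  The averages \<open>E / N\<close> are an approximate unit that asymptotically commutes with \<open>k\<close>.  Each summand \<open>e\<close>
  of \<open>E\<close> is chosen to be nearly a right unit for the finitely many elements built from the previous
  sum that occur in \<open>star [E, k] * [e, k]\<close>; the four terms of this product then cancel.  So the
  commutators with \<open>k\<close> are almost orthogonal, and by Pythagoras the norm of \<open>[E, k]\<close> grows only like
  the square root of \<open>N\<close>.
\<close>

lemma quasicentral_sums:
  fixes S :: "'b::{cstar_algebra, monoid_mult} set"
  assumes S: "closed_ideal S" and x: "x \<in> S" and "\<epsilon> > 0"
  shows "\<exists>E\<in>S. star E \<in> S \<and> norm (real N *\<^sub>R x - x * E) \<le> real N * \<epsilon>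
    \<and> (norm (E * k - k * E))\<^sup>2 \<le> real N * ((2 * norm k)\<^sup>2 + 1)"
proof (induction N)
  case 0
  show ?case using closed_ideal_zero[OF S] by (intro bexI[of _ 0]) simp_all
next
  case (Suc N)
  then obtain E where E: "E \<in> S" "star E \<in> S" "norm (real N *\<^sub>R x - x * E) \<le> real N * \<epsilon>"
    "(norm (E * k - k * E))\<^sup>2 \<le> real N * ((2 * norm k)\<^sup>2 + 1)" by blast
  \<comment> \<open>The four error terms below add up to at most \<open>\<delta> * m\<close>.\<close>
  define m where "m = (1 + norm k) * (1 + norm k)"
  have "m > 0" by (auto simp: m_def intro!: mult_pos_pos add_pos_nonneg)
  define \<delta> where "\<delta> = min \<epsilon> (1 / (2 * m))"
  have \<delta>: "\<delta> > 0" "\<delta> \<le> \<epsilon>" "\<delta> * m \<le> 1 / 2"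
    using \<open>\<epsilon> > 0\<close> \<open>m > 0\<close> by (auto simp: \<delta>_def field_simps min_def)
  define F where "F = {x, star E, star E * k, star E * star k, star E * star k * k}"
  have F: "finite F" "F \<subseteq> S" by (auto simp: F_def x E intro!: closed_ideal_mult_right[OF S])
  obtain e where e: "e \<in> S" "star e \<in> S" "norm (1 - e) \<le> 1"
    "\<And>y. y \<in> F \<Longrightarrow> norm (y - y * e) \<le> \<delta>"
    using approximate_unit[OF S F \<delta>(1)] by blast
  define r where "r y = y - y * e" for y
  have r: "norm (r y) \<le> \<delta>" if "y \<in> F" for y using e(4)[OF that] by (simp add: r_def)
  have "norm (star (E * k - k * E) * (e * k - k * e)) \<le> \<delta> * m"
  proof -
    have "star (E * k - k * E) * (e * k - k * e) =
      (star k * r (star E * k) + r (star E * star k) * k)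
        - (star k * r (star E) * k + r (star E * star k * k))"
      by (simp add: r_def star_diff star_mult algebra_simps)
    also have "norm \<dots> \<le> (norm k * \<delta> + \<delta> * norm k) + (norm k * \<delta> * norm k + \<delta>)"
    proof (intro order_trans[OF norm_triangle_ineq4] order_trans[OF norm_triangle_ineq] add_mono)
      show "norm (star k * r (star E * k)) \<le> norm k * \<delta>"
        using r[of "star E * k"] by (intro order_trans[OF norm_mult_ineq] mult_mono) (auto simp: norm_star F_def)
      show "norm (r (star E * star k) * k) \<le> \<delta> * norm k"
        using r[of "star E * star k"] \<delta> by (intro order_trans[OF norm_mult_ineq] mult_mono) (auto simp: F_def)
      show "norm (star k * r (star E) * k) \<le> norm k * \<delta> * norm k"
        using r[of "star E"] \<delta> by (intro order_trans[OF norm_mult_ineq] mult_mono) (auto simp: norm_star F_def)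
      show "norm (r (star E * star k * k)) \<le> \<delta>" by (rule r) (simp add: F_def)
    qed
    also have "\<dots> = \<delta> * m" by (simp add: m_def algebra_simps)
    finally show ?thesis .
  qed
  then have orth: "norm (star (E * k - k * E) * (e * k - k * e)) \<le> 1 / 2" using \<delta> by linarith
  have "norm (e * k - k * e) = norm (k * (1 - e) - (1 - e) * k)" by (simp add: algebra_simps)
  also have "\<dots> \<le> norm k * 1 + 1 * norm k"
    by (rule order_trans[OF norm_triangle_ineq4 add_mono[OF order_trans[OF norm_mult_ineq mult_left_mono]
          order_trans[OF norm_mult_ineq mult_right_mono]]]) (use e(3) in auto)
  finally have "(norm (e * k - k * e))\<^sup>2 \<le> (2 * norm k)\<^sup>2" by (intro power_mono) auto
  moreover have "(E + e) * k - k * (E + e) = (E * k - k * E) + (e * k - k * e)" by (simp add: algebra_simps)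
  ultimately have "(norm ((E + e) * k - k * (E + e)))\<^sup>2 \<le> real (Suc N) * ((2 * norm k)\<^sup>2 + 1)"
    using norm_sum_almost_orthogonal[OF orth] E(4) by (simp add: algebra_simps)
  moreover have "norm (real (Suc N) *\<^sub>R x - x * (E + e)) \<le> real (Suc N) * \<epsilon>"
  proof -
    have "real (Suc N) *\<^sub>R x - x * (E + e) = (real N *\<^sub>R x - x * E) + r x"
      by (simp add: r_def algebra_simps)
    then have "norm (real (Suc N) *\<^sub>R x - x * (E + e)) \<le> norm (real N *\<^sub>R x - x * E) + norm (r x)"
      by (metis norm_triangle_ineq)
    also have "\<dots> \<le> real N * \<epsilon> + \<epsilon>"
      using E(3) r[of x] \<delta>(2) by (intro add_mono) (auto simp: F_def)
    finally show ?thesis by (simp add: distrib_right)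
  qed
  ultimately show ?case
    using closed_ideal_add[OF S E(1) e(1)] closed_ideal_add[OF S E(2) e(2)]
    by (intro bexI[of _ "E + e"]) (auto simp: star_add)
qed

text \<open>
  For a quasicentral approximate unit \<open>e\<close> of \<open>S\<close>, the element \<open>[k, a]\<close> is close to \<open>[k, a] e\<close>, and
  \<open>[k, a] e - [k, a e] = a [e, k]\<close> is small.
\<close>

lemma commutators_in_ideal_approximable:
  fixes S :: "'b::{cstar_algebra, monoid_mult} set"
  assumes S: "closed_ideal S" and x: "k * a - a * k \<in> S"
  shows "k * a - a * k \<in> closure {k * y - y * k |y. y \<in> S}"
  unfolding closure_approachable
proof (intro allI impI)
  fix \<epsilon> :: real assume "\<epsilon> > 0"
  define x where "x = k * a - a * k"
  define C where "C = (2 * norm k)\<^sup>2 + 1"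
  have "C > 0" by (auto simp: C_def intro: add_nonneg_pos)
  define \<delta> where "\<delta> = \<epsilon> / (2 * (norm a + 1))"
  have na: "norm a + 1 > 0" by (simp add: add_nonneg_pos)
  then have "\<delta> > 0" using \<open>\<epsilon> > 0\<close> by (simp add: \<delta>_def)
  obtain N :: nat where N: "C / \<delta>\<^sup>2 < real N" using reals_Archimedean2 by blast
  moreover have "C / \<delta>\<^sup>2 > 0" using \<open>C > 0\<close> \<open>\<delta> > 0\<close> by simp
  ultimately have "real N > 0" by linarith
  obtain E where E: "E \<in> S" "norm (real N *\<^sub>R x - x * E) \<le> real N * (\<epsilon> / 2)"
    "(norm (E * k - k * E))\<^sup>2 \<le> real N * C"
    using quasicentral_sums[OF S x, of "\<epsilon> / 2" N k] \<open>\<epsilon> > 0\<close> unfolding x_def C_def by auto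
  define e where "e = (1 / real N) *\<^sub>R E"
  have E_eq: "E = real N *\<^sub>R e" using \<open>real N > 0\<close> by (simp add: e_def)
  have "norm (real N *\<^sub>R x - x * E) = real N * norm (x - x * e)"
    unfolding E_eq by (simp add: scaleR_diff_right[symmetric])
  then have xe: "norm (x - x * e) \<le> \<epsilon> / 2" using E(2) \<open>real N > 0\<close> by simp
  have "norm (E * k - k * E) = real N * norm (e * k - k * e)"
    unfolding E_eq by (simp add: scaleR_diff_right[symmetric])
  then have "real N * (real N * (norm (e * k - k * e))\<^sup>2) \<le> real N * C"
    using E(3) by (simp add: power_mult_distrib power2_eq_square mult_ac)
  then have "real N * (norm (e * k - k * e))\<^sup>2 \<le> C" using \<open>real N > 0\<close> by simp
  also have "C < real N * \<delta>\<^sup>2" using N \<open>\<delta> > 0\<close> by (simp add: field_simps)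
  finally have "(norm (e * k - k * e))\<^sup>2 < \<delta>\<^sup>2" using \<open>real N > 0\<close> by simp
  then have ek: "norm (e * k - k * e) < \<delta>" using \<open>\<delta> > 0\<close> by (simp add: power2_less_imp_less)
  have "norm (a * (e * k - k * e)) \<le> norm a * \<delta>"
    using ek by (intro order_trans[OF norm_mult_ineq] mult_left_mono) auto
  also have "\<dots> < (norm a + 1) * \<delta>" using \<open>\<delta> > 0\<close> by simp
  also have "\<dots> = \<epsilon> / 2" using na by (simp add: \<delta>_def field_simps)
  finally have "norm (a * (e * k - k * e)) < \<epsilon> / 2" .
  moreover have "k * (a * e) - (a * e) * k - x = - (x - x * e) - a * (e * k - k * e)"
    by (simp add: x_def algebra_simps)
  then have "dist (k * (a * e) - (a * e) * k) x \<le> norm (x - x * e) + norm (a * (e * k - k * e))"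
    unfolding dist_norm by (metis norm_minus_cancel norm_triangle_ineq4)
  ultimately have "dist (k * (a * e) - (a * e) * k) x < \<epsilon>" using xe by linarith
  moreover have "a * e \<in> S"
    unfolding e_def using E(1) by (intro closed_ideal_mult_left[OF S] closed_ideal_scaleR[OF S])
  ultimately show "\<exists>y\<in>{k * y - y * k |y. y \<in> S}. dist y (k * a - a * k) < \<epsilon>"
    unfolding x_def by blast
qed


section \<open>Lie ideals\<close>

text \<open>
  Let \<open>T\<close> consist of all \<open>t\<close> with \<open>[t, A] \<subseteq> L\<close>.  By \<open>[s t, a] = [s, t a] + [t, a s]\<close> it is a closed
  subalgebra, and it contains \<open>L\<close> and \<open>M\<close>.  Let \<open>J\<close> be the largest ideal inside \<open>T\<close>.  Herstein's identity
  \<open>[s, t] a = [s, t a] - t [s, a]\<close> shows \<open>[T, T] \<subseteq> J\<close>.  For \<open>k \<in> M\<close> the derivation \<open>D = [k, \<cdot>]\<close> maps \<open>A\<close> into \<open>L\<close>,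
  and so \<open>D\<^sup>2\<close> maps it into \<open>J\<close>.  Leibniz' rule then gives first \<open>D a * D b \<in> J\<close> and next
  \<open>D a * c * D a \<in> J\<close>, and \<open>D a \<in> J\<close> because closed ideals of C*-algebras are semiprime.
\<close>

lemma Lie_ideal_contains_commutators_of_ideal:
  fixes L M :: "'a::cstar_algebra set"
  assumes L: "closed L" "0 \<in> L" "\<And>x y. x \<in> L \<Longrightarrow> y \<in> L \<Longrightarrow> x + y \<in> L" "\<And>x. x \<in> L \<Longrightarrow> - x \<in> L"
    and Lie: "\<And>x a. x \<in> L \<Longrightarrow> x * a - a * x \<in> L"
    and M: "\<And>k a. k \<in> M \<Longrightarrow> k * a - a * k \<in> L"
    and x: "x \<in> closed_ideal hull {k * a - a * k |k a. k \<in> M}"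
  shows "x * b - b * x \<in> L"
proof -
  define T where "T = {t. \<forall>a. t * a - a * t \<in> L}"
  define J where "J = {x. x \<in> T \<and> (\<forall>a. a * x \<in> T) \<and> (\<forall>b. x * b \<in> T) \<and> (\<forall>a b. a * x * b \<in> T)}"
  have TD: "t * a - a * t \<in> L" if "t \<in> T" for t a using that by (simp add: T_def)
  have L_diff: "x - y \<in> L" if "x \<in> L" "y \<in> L" for x y
    using L(3)[OF that(1) L(4)[OF that(2)]] by simp
  have LT: "L \<subseteq> T" using Lie by (auto simp: T_def)
  have T_0: "0 \<in> T" by (simp add: T_def L)
  have T_add: "s + t \<in> T" if "s \<in> T" "t \<in> T" for s t
    unfolding T_def
  proof (intro CollectI allI)
    fix a
    have "(s + t) * a - a * (s + t) = (s * a - a * s) + (t * a - a * t)" by (simp add: algebra_simps)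
    then show "(s + t) * a - a * (s + t) \<in> L" using L(3) TD that by simp
  qed
  have T_scaleC: "c *\<^sub>C t \<in> T" if "t \<in> T" for c t
    using TD[OF that, of "c *\<^sub>C _"] by (simp add: T_def mult_scaleC_left mult_scaleC_right)
  have T_diff: "s - t \<in> T" if "s \<in> T" "t \<in> T" for s t
    using T_add[OF that(1) T_scaleC[OF that(2), of "-1"]]
    by (simp add: complex_vector.scale_minus_left scaleC_one)
  have T_mult: "s * t \<in> T" if "s \<in> T" "t \<in> T" for s t
    unfolding T_def
  proof (intro CollectI allI)
    fix a
    have "s * t * a - a * (s * t) = (s * (t * a) - (t * a) * s) + (t * (a * s) - (a * s) * t)"
      by (simp add: algebra_simps)
    then show "s * t * a - a * (s * t) \<in> L" using L(3)[OF TD TD, OF that] by simp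
  qed
  have closed_vimage_T: "closed {x. f x \<in> T}" if "continuous_on UNIV f" for f
  proof -
    have "{x. f x \<in> T} = (\<Inter>a. (\<lambda>x. f x * a - a * f x) -` L)" by (auto simp: T_def)
    then show ?thesis
      using that L(1) by (auto intro!: closed_INT closed_vimage continuous_intros)
  qed
  have "closed J"
  proof -
    have "J = {x. x \<in> T} \<inter> (\<Inter>a. {x. a * x \<in> T}) \<inter> (\<Inter>b. {x. x * b \<in> T})
      \<inter> (\<Inter>a. \<Inter>b. {x. a * x * b \<in> T})" by (auto simp: J_def)
    also have "closed \<dots>"
      by (intro closed_Int closed_INT ballI closed_vimage_T continuous_intros)
    finally show ?thesis .
  qed
  moreover have "complex_vector.subspace J"
    by (rule complex_vector.subspaceI)
      (auto simp: J_def T_0 T_add T_scaleC distrib_left distrib_right mult_scaleC_left mult_scaleC_right)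
  moreover have "a * x \<in> J" "x * a \<in> J" if "x \<in> J" for a x
    using that by (auto simp: J_def mult.assoc[symmetric]) (auto simp: mult.assoc)
  ultimately have J: "closed_ideal J" by (simp add: closed_ideal_def)
  have TT: "s * t - t * s \<in> J" if s: "s \<in> T" and t: "t \<in> T" for s t
  proof -
    have right: "(s * t - t * s) * a \<in> T" for a
    proof -
      have "s * (t * a) - (t * a) * s \<in> T" using TD[OF s] LT by blast
      moreover have "t * (s * a - a * s) \<in> T" using T_mult[OF t] TD[OF s] LT by blast
      ultimately have "(s * (t * a) - (t * a) * s) - t * (s * a - a * s) \<in> T" by (rule T_diff)
      then show ?thesis by (simp add: algebra_simps)
    qed
    have left: "a * z \<in> T" if "z \<in> T" "z * a \<in> T" for a z
    proof -
      have "z * a - a * z \<in> T" using TD[OF that(1)] LT by blast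
      from T_diff[OF that(2) this] show ?thesis by simp
    qed
    have "s * t - t * s \<in> T" by (intro T_diff T_mult s t)
    moreover have "a * ((s * t - t * s) * b) \<in> T" for a b
      by (rule left) (use right[of "b * a"] right[of b] in \<open>simp_all add: mult.assoc\<close>)
    ultimately show ?thesis
      using right left unfolding J_def by (simp add: mult.assoc)
  qed
  have gen: "k * a - a * k \<in> J" if k: "k \<in> M" for k a
  proof -
    define D where "D a = k * a - a * k" for a
    have "k \<in> T" using M[OF k] by (simp add: T_def)
    moreover have "D a \<in> T" for a using M[OF k, of a] LT by (auto simp: D_def)
    ultimately have DD: "D (D a) \<in> J" for a using TT[of k "D a"] by (simp add: D_def[of "D a"])
    have prod: "D a * D b \<in> J" for a b
    proof -
      have "D (D (a * b)) - D (D a) * b - a * D (D b) = 2 *\<^sub>R (D a * D b)"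
        by (simp add: D_def algebra_simps scaleR_2)
      moreover have "D (D (a * b)) - D (D a) * b - a * D (D b) \<in> J"
        by (intro closed_ideal_diff[OF J] closed_ideal_mult_left[OF J] closed_ideal_mult_right[OF J] DD)
      ultimately have "2 *\<^sub>R (D a * D b) \<in> J" by simp
      from closed_ideal_scaleR[OF J this, of "1 / 2"] show ?thesis by simp
    qed
    have "D a * star (D a) * D a = D a * D (star (D a) * a) - D a * D (star (D a)) * a"
      by (simp add: D_def algebra_simps)
    also have "\<dots> \<in> J"
      by (intro closed_ideal_diff[OF J] closed_ideal_mult_right[OF J] prod)
    finally have "D a \<in> J" by (rule closed_ideal_semiprime[OF J])
    then show ?thesis by (simp add: D_def)
  qed
  have "closed_ideal hull {k * a - a * k |k a. k \<in> M} \<subseteq> J"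
    by (rule hull_minimal) (use gen J in auto)
  with x have "x \<in> T" by (auto simp: J_def)
  then show ?thesis by (rule TD)
qed


section \<open>Tangent vectors at the identity\<close>

text \<open>
  The velocities at \<open>1\<close> of paths in \<open>K\<close>, as in the definition of the Lie algebra of a closed linear
  group, but expressed by approximation to first order.  No curve or one-parameter subgroup has to be
  produced, and closedness of the set of all tangent vectors is immediate.
\<close>

definition tangent :: "'b::{real_normed_algebra, monoid_mult} set \<Rightarrow> 'b set"
  where "tangent K =
    {x. \<forall>\<epsilon>>0. \<forall>\<^sub>F s in at (0::real). \<exists>k\<in>K. norm (k - 1 - s *\<^sub>R x) \<le> \<epsilon> * \<bar>s\<bar>}"

lemma tangentD:
  "x \<in> tangent K \<Longrightarrow> \<epsilon> > 0 \<Longrightarrow> \<forall>\<^sub>F s in at 0. \<exists>k\<in>K. norm (k - 1 - s *\<^sub>R x) \<le> \<epsilon> * \<bar>s\<bar>"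
  by (simp add: tangent_def)

lemma eventually_abs_mult_le:
  fixes c C :: real
  assumes "c > 0"
  shows "\<forall>\<^sub>F s in at 0. \<bar>s\<bar> * C \<le> c"
proof -
  have "((\<lambda>s. \<bar>s\<bar> * C) \<longlongrightarrow> \<bar>0\<bar> * C) (at 0)" by (intro tendsto_intros)
  then have "((\<lambda>s. \<bar>s\<bar> * C) \<longlongrightarrow> 0) (at 0)" by simp
  from order_tendstoD(2)[OF this assms] show ?thesis by (rule eventually_mono) simp
qed

lemma tangent_zero: "1 \<in> K \<Longrightarrow> 0 \<in> tangent K"
  unfolding tangent_def by (auto intro!: always_eventually bexI[of _ 1])

lemma tangent_add:
  assumes K: "\<And>k l. k \<in> K \<Longrightarrow> l \<in> K \<Longrightarrow> k * l \<in> K" and x: "x \<in> tangent K" and y: "y \<in> tangent K"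
  shows "x + y \<in> tangent K"
  unfolding tangent_def
proof (intro CollectI allI impI)
  fix \<epsilon> :: real assume "\<epsilon> > 0"
  define n where "n = norm (1 :: 'a)"
  define \<delta> where "\<delta> = min 1 (\<epsilon> / (2 * n + 4))"
  have n: "2 * n + 4 > 0" by (simp add: n_def add_nonneg_pos)
  then have \<delta>: "\<delta> > 0" "\<delta> \<le> 1" "(2 * n + 4) * \<delta> \<le> \<epsilon>"
    using \<open>\<epsilon> > 0\<close> mult_left_mono[of \<delta> "\<epsilon> / (2 * n + 4)" "2 * n + 4"] by (auto simp: \<delta>_def)
  show "\<forall>\<^sub>F s in at 0. \<exists>k\<in>K. norm (k - 1 - s *\<^sub>R (x + y)) \<le> \<epsilon> * \<bar>s\<bar>"
    using tangentD[OF x \<delta>(1)] tangentD[OF y \<delta>(1)]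
      eventually_abs_mult_le[OF zero_less_one, of 1] eventually_abs_mult_le[OF zero_less_one, of "norm x"]
      eventually_abs_mult_le[OF zero_less_one, of "norm y"] eventually_abs_mult_le[OF \<delta>(1), of "norm x * norm y"]
  proof (eventually_elim)
    case (elim s)
    then obtain k l where k: "k \<in> K" "norm (k - 1 - s *\<^sub>R x) \<le> \<delta> * \<bar>s\<bar>"
      and l: "l \<in> K" "norm (l - 1 - s *\<^sub>R y) \<le> \<delta> * \<bar>s\<bar>" by blast
    have "\<delta> * \<bar>s\<bar> \<le> 1 * 1" using elim \<delta> by (intro mult_mono) auto
    have "l = 1 + s *\<^sub>R y + (l - 1 - s *\<^sub>R y)" by simp
    then have "norm l \<le> n + norm (s *\<^sub>R y) + norm (l - 1 - s *\<^sub>R y)"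
      unfolding n_def by (metis norm_triangle_ineq norm_triangle_mono order_refl)
    then have nl: "norm l \<le> n + 2" using l(2) \<open>\<delta> * \<bar>s\<bar> \<le> 1 * 1\<close> elim by simp
    have nx: "norm (1 + s *\<^sub>R x) \<le> n + 1"
      using norm_triangle_ineq[of 1 "s *\<^sub>R x"] elim by (simp add: n_def)
    have "k * l - 1 - s *\<^sub>R (x + y) =
        ((k - 1 - s *\<^sub>R x) * l + (1 + s *\<^sub>R x) * (l - 1 - s *\<^sub>R y)) + (s * s) *\<^sub>R (x * y)"
      by (simp add: algebra_simps)
    also have "norm \<dots> \<le> (\<delta> * \<bar>s\<bar> * (n + 2) + (n + 1) * (\<delta> * \<bar>s\<bar>)) + \<delta> * \<bar>s\<bar>"
    proof (rule order_trans[OF norm_triangle_ineq add_mono[OF order_trans[OF norm_triangle_ineq add_mono]]])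
      show "norm ((k - 1 - s *\<^sub>R x) * l) \<le> \<delta> * \<bar>s\<bar> * (n + 2)"
        using k(2) nl by (intro order_trans[OF norm_mult_ineq] mult_mono) (use \<delta> in auto)
      show "norm ((1 + s *\<^sub>R x) * (l - 1 - s *\<^sub>R y)) \<le> (n + 1) * (\<delta> * \<bar>s\<bar>)"
        using l(2) nx by (intro order_trans[OF norm_mult_ineq] mult_mono) (auto simp: n_def)
      have "norm ((s * s) *\<^sub>R (x * y)) \<le> \<bar>s\<bar> * (\<bar>s\<bar> * (norm x * norm y))"
        unfolding norm_scaleR abs_mult mult.assoc by (intro mult_left_mono norm_mult_ineq) auto
      also have "\<dots> \<le> \<bar>s\<bar> * \<delta>" using elim by (intro mult_left_mono) auto
      finally show "norm ((s * s) *\<^sub>R (x * y)) \<le> \<delta> * \<bar>s\<bar>" by (simp add: mult.commute)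
    qed
    also have "\<dots> = (2 * n + 4) * \<delta> * \<bar>s\<bar>" by (simp add: algebra_simps)
    also have "\<dots> \<le> \<epsilon> * \<bar>s\<bar>" using \<delta>(3) by (rule mult_right_mono) simp
    finally show ?case using K[OF k(1) l(1)] by blast
  qed
qed

lemma tangent_scaleR:
  assumes x: "x \<in> tangent K" and "c \<noteq> 0"
  shows "c *\<^sub>R x \<in> tangent K"
  unfolding tangent_def
proof (intro CollectI allI impI)
  fix \<epsilon> :: real assume "\<epsilon> > 0"
  have "filterlim (\<lambda>s. s * c) (at 0) (at 0)"
    using \<open>c \<noteq> 0\<close> by (auto simp: filterlim_at eventually_at_filter intro!: tendsto_eq_intros)
  from eventually_compose_filterlim[OF tangentD[OF x, of "\<epsilon> / \<bar>c\<bar>"] this] \<open>\<epsilon> > 0\<close> \<open>c \<noteq> 0\<close>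
  show "\<forall>\<^sub>F s in at 0. \<exists>k\<in>K. norm (k - 1 - s *\<^sub>R c *\<^sub>R x) \<le> \<epsilon> * \<bar>s\<bar>"
    by (simp add: abs_mult field_simps)
qed

lemma tangent_minus: "x \<in> tangent K \<Longrightarrow> - x \<in> tangent K"
  using tangent_scaleR[of x K "-1"] by simp

lemma tangent_diff:
  assumes "\<And>k l. k \<in> K \<Longrightarrow> l \<in> K \<Longrightarrow> k * l \<in> K" "x \<in> tangent K" "y \<in> tangent K"
  shows "x - y \<in> tangent K"
  using tangent_add[OF assms(1,2) tangent_minus[OF assms(3)]] by simp

lemma closed_tangent: "closed (tangent K)"
proof -
  have "x \<in> tangent K" if x: "x \<in> closure (tangent K)" for x
    unfolding tangent_def
  proof (intro CollectI allI impI)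
    fix \<epsilon> :: real assume "\<epsilon> > 0"
    then obtain y where y: "y \<in> tangent K" "norm (y - x) < \<epsilon> / 2"
      using closure_approachableD[OF x, of "\<epsilon> / 2"] by (auto simp: dist_norm norm_minus_commute)
    from tangentD[OF y(1), of "\<epsilon> / 2"] \<open>\<epsilon> > 0\<close>
    have "\<forall>\<^sub>F s in at 0. \<exists>k\<in>K. norm (k - 1 - s *\<^sub>R y) \<le> \<epsilon> / 2 * \<bar>s\<bar>" by simp
    then show "\<forall>\<^sub>F s in at 0. \<exists>k\<in>K. norm (k - 1 - s *\<^sub>R x) \<le> \<epsilon> * \<bar>s\<bar>"
    proof eventually_elim
      case (elim s)
      then obtain k where k: "k \<in> K" "norm (k - 1 - s *\<^sub>R y) \<le> \<epsilon> / 2 * \<bar>s\<bar>" by blast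
      have "k - 1 - s *\<^sub>R x = (k - 1 - s *\<^sub>R y) + s *\<^sub>R (y - x)" by (simp add: algebra_simps)
      then have "norm (k - 1 - s *\<^sub>R x) \<le> norm (k - 1 - s *\<^sub>R y) + \<bar>s\<bar> * norm (y - x)"
        by (metis norm_scaleR norm_triangle_ineq)
      also have "\<dots> \<le> \<epsilon> / 2 * \<bar>s\<bar> + \<bar>s\<bar> * (\<epsilon> / 2)"
        using k(2) y(2) by (intro add_mono mult_left_mono) auto
      finally show ?case using k(1) by (auto simp: mult.commute)
    qed
  qed
  then show ?thesis using closure_subset[of "tangent K"] by (metis closure_closed closed_closure subsetI subset_antisym)
qed

lemma tangent_conjugate:
  assumes "g * h = 1" and K: "\<And>k. k \<in> K \<Longrightarrow> g * k * h \<in> K" and x: "x \<in> tangent K"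
  shows "g * x * h \<in> tangent K"
  unfolding tangent_def
proof (intro CollectI allI impI)
  fix \<epsilon> :: real assume "\<epsilon> > 0"
  define m where "m = norm g * norm h + 1"
  have "m > 0" by (simp add: m_def add_nonneg_pos)
  then have "\<epsilon> / m > 0" using \<open>\<epsilon> > 0\<close> by simp
  from tangentD[OF x this]
  show "\<forall>\<^sub>F s in at 0. \<exists>k\<in>K. norm (k - 1 - s *\<^sub>R (g * x * h)) \<le> \<epsilon> * \<bar>s\<bar>"
  proof eventually_elim
    case (elim s)
    then obtain k where k: "k \<in> K" "norm (k - 1 - s *\<^sub>R x) \<le> \<epsilon> / m * \<bar>s\<bar>" by blast
    have "g * k * h - 1 - s *\<^sub>R (g * x * h) = g * (k - 1 - s *\<^sub>R x) * h"
      using assms(1) by (simp add: algebra_simps)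
    also have "norm \<dots> \<le> norm g * (\<epsilon> / m * \<bar>s\<bar>) * norm h"
      by (rule order_trans[OF norm_mult_ineq mult_right_mono[OF order_trans[OF norm_mult_ineq mult_left_mono]]])
        (use k in auto)
    also have "\<dots> = (norm g * norm h) * (\<epsilon> / m * \<bar>s\<bar>)" by simp
    also have "\<dots> \<le> m * (\<epsilon> / m * \<bar>s\<bar>)"
      using mult_nonneg_nonneg[OF less_imp_le[OF \<open>\<epsilon> / m > 0\<close>], of "\<bar>s\<bar>"]
      by (intro mult_right_mono) (simp_all add: m_def)
    also have "\<dots> = \<epsilon> * \<bar>s\<bar>" using \<open>m > 0\<close> by simp
    finally show ?case using K[OF k(1)] by blast
  qed
qed

text \<open>
  A path \<open>d\<close> with \<open>d\<^sup>-\<^sup>1 d'\<close> tangent to \<open>K\<close> cannot leave the closure of \<open>K\<close>.  On a short interval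
  \<open>[a, b]\<close> around \<open>x\<close>, the tangent vector at \<open>x\<close> provides \<open>k \<in> K\<close> with \<open>d a * k = z * d b\<close> and \<open>z\<close>
  within \<open>\<eta> (b - a)\<close> of \<open>1\<close>.  Bounding \<open>norm (z - 1)\<close> by \<open>exp (\<eta> (b - a)) - 1\<close> instead makes the property
  pass from adjacent intervals to their union, and bisection gives it on all of \<open>[0, 1]\<close>.
\<close>

lemma path_with_tangent_velocity_ends_in_closure:
  fixes K :: "'b::{real_normed_algebra, monoid_mult} set" and d D l :: "real \<Rightarrow> 'b"
  assumes norm_1: "norm (1 :: 'b) \<le> 1"
    and K: "1 \<in> K" "\<And>k l. k \<in> K \<Longrightarrow> l \<in> K \<Longrightarrow> k * l \<in> K"
    and d: "\<And>t. t \<in> {0..1} \<Longrightarrow> (d has_vector_derivative d t * l t) (at t within {0..1})"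
    and l: "\<And>t. t \<in> {0..1} \<Longrightarrow> l t \<in> tangent K"
    and D: "\<And>t. t \<in> {0..1} \<Longrightarrow> d t * D t = 1" "\<And>t. t \<in> {0..1} \<Longrightarrow> D t * d t = 1"
      "\<And>t. t \<in> {0..1} \<Longrightarrow> norm (D t) \<le> M"
    and d0: "d 0 = 1"
  shows "d 1 \<in> closure K"
  unfolding closure_approachable
proof (intro allI impI)
  fix e :: real assume "e > 0"
  \<comment> \<open>The rate for which the final error \<open>(exp \<eta> - 1) norm (d 1)\<close> is less than \<open>e\<close>.\<close>
  define \<eta> where "\<eta> = ln (1 + e / (norm (d 1) + 1))"
  have n1: "norm (d 1) + 1 > 0" by (simp add: add_nonneg_pos)
  then have \<eta>: "\<eta> > 0" "exp \<eta> - 1 = e / (norm (d 1) + 1)"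
    using \<open>e > 0\<close> by (simp_all add: \<eta>_def add_pos_pos)
  define P where "P a b \<longleftrightarrow> (0 \<le> a \<longrightarrow> b \<le> 1 \<longrightarrow>
    (\<exists>k\<in>K. \<exists>z. d a * k = z * d b \<and> norm (z - 1) \<le> exp (\<eta> * (b - a)) - 1))" for a b
  have "(0::real) \<le> 1" by simp
  then have "P 0 1"
  proof (induction rule: Bolzano)
    case (trans a b c)
    show ?case
      unfolding P_def
    proof (intro impI)
      assume "0 \<le> a" "c \<le> 1"
      then obtain k z k' z' where k: "k \<in> K" "d a * k = z * d b" "norm (z - 1) \<le> exp (\<eta> * (b - a)) - 1"
        and k': "k' \<in> K" "d b * k' = z' * d c" "norm (z' - 1) \<le> exp (\<eta> * (c - b)) - 1"
        using trans order_trans[of 0 a b] order_trans[of b c 1] unfolding P_def by blast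
      have "d a * (k * k') = z * z' * d c" by (metis k(2) k'(2) mult.assoc)
      moreover have "norm (z * z' - 1) \<le> exp (\<eta> * (c - a)) - 1"
      proof -
        have "norm z' \<le> norm (z' - 1) + norm (1 :: 'b)" by (metis diff_add_cancel norm_triangle_ineq)
        then have z': "norm z' \<le> exp (\<eta> * (c - b))" using k'(3) norm_1 by linarith
        have "z * z' - 1 = (z - 1) * z' + (z' - 1)" by (simp add: algebra_simps)
        then have "norm (z * z' - 1) \<le> norm (z - 1) * norm z' + norm (z' - 1)"
          by (metis add_right_mono norm_mult_ineq norm_triangle_ineq order_trans)
        also have "\<dots> \<le> (exp (\<eta> * (b - a)) - 1) * exp (\<eta> * (c - b)) + (exp (\<eta> * (c - b)) - 1)"
          using k(3) k'(3) z' by (intro add_mono mult_mono) (use \<open>a \<le> b\<close> \<eta>(1) in auto)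
        also have "\<dots> = exp (\<eta> * (b - a) + \<eta> * (c - b)) - 1" by (simp add: exp_add left_diff_distrib)
        also have "\<eta> * (b - a) + \<eta> * (c - b) = \<eta> * (c - a)" by (simp add: algebra_simps)
        finally show ?thesis .
      qed
      ultimately show "\<exists>k\<in>K. \<exists>z. d a * k = z * d c \<and> norm (z - 1) \<le> exp (\<eta> * (c - a)) - 1"
        using K(2)[OF k(1) k'(1)] by blast
    qed
  next
    case (local x)
    then have x: "x \<in> {0..1}" by simp
    define C where "C = (norm (d x) + 1 + norm (l x) + 1) * (M + 1)"
    have "M \<ge> 0" using D(3)[OF x] norm_ge_zero order_trans by blast
    then have "C > 0"
      using norm_ge_zero[of "d x"] norm_ge_zero[of "l x"]
      unfolding C_def by (intro mult_pos_pos) linarith+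
    define \<epsilon> where "\<epsilon> = min 1 (\<eta> / C)"
    have \<epsilon>: "\<epsilon> > 0" "\<epsilon> \<le> 1" "C * \<epsilon> \<le> \<eta>" 
      using \<eta>(1) \<open>C > 0\<close> mult_left_mono[of \<epsilon> "\<eta> / C" C] by (auto simp: \<epsilon>_def)
    obtain \<delta>1 where \<delta>1: "\<delta>1 > 0" "\<And>y. y \<in> {0..1} \<Longrightarrow> norm (y - x) < \<delta>1 \<Longrightarrow>
        norm (d y - d x - (y - x) *\<^sub>R (d x * l x)) \<le> \<epsilon> * norm (y - x)"
      using d[OF x] \<epsilon>(1) unfolding has_vector_derivative_def has_derivative_within_alt by meson
    have "continuous (at x within {0..1}) d"
      using d[OF x] by (rule has_vector_derivative_continuous)
    then obtain \<delta>2 where \<delta>2: "\<delta>2 > 0" "\<And>y. y \<in> {0..1} \<Longrightarrow> dist y x < \<delta>2 \<Longrightarrow> dist (d y) (d x) < \<epsilon>"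
      using \<epsilon>(1) unfolding continuous_within_eps_delta by meson
    obtain \<delta>3 where \<delta>3: "\<delta>3 > 0" "\<And>s. s \<noteq> 0 \<Longrightarrow> dist s 0 < \<delta>3 \<Longrightarrow>
        \<exists>k\<in>K. norm (k - 1 - s *\<^sub>R l x) \<le> \<epsilon> * \<bar>s\<bar>"
      using tangentD[OF l[OF x] \<epsilon>(1)] unfolding eventually_at by auto
    have "P a b" if ab: "a \<le> x" "x \<le> b" "b - a < min \<delta>1 (min \<delta>2 \<delta>3)" for a b
      unfolding P_def
    proof (intro impI)
      assume "0 \<le> a" "b \<le> 1"
      then have in01: "a \<in> {0..1}" "b \<in> {0..1}" using ab x by auto
      show "\<exists>k\<in>K. \<exists>z. d a * k = z * d b \<and> norm (z - 1) \<le> exp (\<eta> * (b - a)) - 1"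
      proof (cases "a = b")
        case True
        then show ?thesis using K(1) by (intro bexI[of _ 1] exI[of _ 1]) auto
      next
        case False
        define s where "s = b - a"
        have s: "s > 0" using ab False by (simp add: s_def)
        then obtain k where k: "k \<in> K" "norm (k - 1 - s *\<^sub>R l x) \<le> \<epsilon> * s"
          using \<delta>3(2)[of s] ab by (auto simp: s_def dist_norm)
        define z where "z = d a * k * D b"
        have z: "d a * k = z * d b" by (simp add: z_def mult.assoc D(2)[OF in01(2)])
        define ra where "ra = d a - d x - (a - x) *\<^sub>R (d x * l x)"
        define rb where "rb = d b - d x - (b - x) *\<^sub>R (d x * l x)"
        have rab: "norm ra \<le> \<epsilon> * (x - a)" "norm rb \<le> \<epsilon> * (b - x)"
          using \<delta>1(2)[OF in01(1)] \<delta>1(2)[OF in01(2)] ab by (auto simp: ra_def rb_def)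
        have da: "norm (d a - d x) \<le> \<epsilon>"
          using \<delta>2(2)[OF in01(1)] ab by (auto simp: dist_norm)
        have nda: "norm (d a) \<le> norm (d x) + 1"
          using da \<epsilon>(2) norm_triangle_ineq2[of "d a" "d x"] by linarith
        have "d a * k - d b = (d a * (k - 1 - s *\<^sub>R l x) + (d a - d x) * (s *\<^sub>R l x)) + (ra - rb)"
          by (simp add: ra_def rb_def s_def algebra_simps)
        also have "norm \<dots> \<le> ((norm (d x) + 1) * (\<epsilon> * s) + \<epsilon> * (s * norm (l x))) + (\<epsilon> * (x - a) + \<epsilon> * (b - x))"
        proof (rule order_trans[OF norm_triangle_ineq add_mono[OF order_trans[OF norm_triangle_ineq add_mono]
                order_trans[OF norm_triangle_ineq4 add_mono]]])
          show "norm (d a * (k - 1 - s *\<^sub>R l x)) \<le> (norm (d x) + 1) * (\<epsilon> * s)"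
            using k(2) nda by (intro order_trans[OF norm_mult_ineq] mult_mono) auto
          show "norm ((d a - d x) * (s *\<^sub>R l x)) \<le> \<epsilon> * (s * norm (l x))"
            using da s \<epsilon> by (intro order_trans[OF norm_mult_ineq] mult_mono) auto
        qed (use rab in auto)
        also have "\<dots> = (norm (d x) + 1 + norm (l x) + 1) * \<epsilon> * s" by (simp add: s_def algebra_simps)
        finally have "norm (d a * k - d b) \<le> (norm (d x) + 1 + norm (l x) + 1) * \<epsilon> * s" .
        moreover have "z - 1 = (d a * k - d b) * D b" by (simp add: z_def left_diff_distrib D(1)[OF in01(2)])
        moreover have "norm (D b) \<le> M + 1" using D(3)[OF in01(2)] by simp
        ultimately have "norm (z - 1) \<le> (norm (d x) + 1 + norm (l x) + 1) * \<epsilon> * s * (M + 1)"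
          using s \<epsilon> by (auto intro!: order_trans[OF norm_mult_ineq] mult_mono)
        also have "\<dots> = C * \<epsilon> * s" by (simp add: C_def)
        also have "\<dots> \<le> \<eta> * s" using \<epsilon>(3) s by (intro mult_right_mono) auto
        also have "\<dots> \<le> exp (\<eta> * s) - 1" using exp_ge_add_one_self[of "\<eta> * s"] by linarith
        finally show ?thesis using k(1) z unfolding s_def by blast
      qed
    qed
    then show ?case using \<delta>1(1) \<delta>2(1) \<delta>3(1) by (intro exI[of _ "min \<delta>1 (min \<delta>2 \<delta>3)"]) auto
  qed
  then obtain k z where k: "k \<in> K" "k = z * d 1" "norm (z - 1) \<le> exp \<eta> - 1"
    unfolding P_def by (auto simp: d0)
  have "k - d 1 = (z - 1) * d 1" by (simp add: k(2) left_diff_distrib)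
  then have "dist k (d 1) \<le> norm (z - 1) * norm (d 1)" unfolding dist_norm by (metis norm_mult_ineq)
  also have "\<dots> \<le> (exp \<eta> - 1) * norm (d 1)" using k(3) by (rule mult_right_mono) simp
  also have "\<dots> < e" using \<open>e > 0\<close> n1 by (simp add: \<eta>(2) field_simps)
  finally show "\<exists>k\<in>K. dist k (d 1) < e" using k(1) by blast
qed


section \<open>The connected groups of invertibles\<close>

abbreviation GA :: "'a::cstar_algebra unitization monoid"
  where "GA \<equiv> G_of UNIV"

abbreviation ginv :: "'a::cstar_algebra unitization \<Rightarrow> 'a unitization"
  where "ginv u \<equiv> inv\<^bsub>GA\<^esub> u"

abbreviation gcomm :: "'a::cstar_algebra unitization \<Rightarrow> 'a unitization \<Rightarrow> 'a unitization"
  where "gcomm u v \<equiv> u * v * ginv u * ginv v"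

lemma emb_diff: "emb (x - y) = emb x - emb y"
  and emb_minus: "emb (- x) = - emb x"
  and emb_scaleR: "emb (r *\<^sub>R x) = r *\<^sub>R emb x"
  and emb_zero: "emb 0 = 0"
  by (simp_all add: bounded_linear.linear[OF bounded_linear_emb] linear_diff linear_neg linear_scale linear_0)

lemma G_of_simps:
  "x \<otimes>\<^bsub>G_of I\<^esub> y = x * y" "\<one>\<^bsub>G_of I\<^esub> = 1"
  by (simp_all add: G_of_def)

lemma carrier_G_of: "carrier (G_of I) = connected_component_set (GL I) 1"
  by (simp add: G_of_def)

lemma group_GA: "group GA"
  by (rule group_G_of[OF closed_ideal_UNIV])

text \<open>
  An inverse in the unitization of an element \<open>1 + x\<close> with \<open>x \<in> I\<close> automatically lies in \<open>1 + I\<close>, since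
  \<open>v = 1 - x v\<close>.
\<close>

lemma GL_iff:
  assumes I: "closed_ideal I"
  shows "u \<in> GL I \<longleftrightarrow> (\<exists>x\<in>I. u = 1 + emb x) \<and> (\<exists>v. u * v = 1 \<and> v * u = 1)"
proof
  assume "(\<exists>x\<in>I. u = 1 + emb x) \<and> (\<exists>v. u * v = 1 \<and> v * u = 1)"
  then obtain x v where x: "x \<in> I" "u = 1 + emb x" and v: "u * v = 1" "v * u = 1" by blast
  obtain y where y: "y \<in> I" "emb x * v = emb y"
    using closed_ideal_mult_right[OF closed_ideal_emb[OF I], of "emb x" v] x(1) by blast
  have "v = 1 - emb x * v" using v(1) by (simp add: x(2) distrib_right eq_diff_eq)
  then have "v = 1 *\<^sub>C 1 + emb (- y)" by (simp add: y emb_minus scaleC_one)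
  then have "v \<in> unitization_of I"
    using closed_ideal_minus[OF I y(1)] unfolding unitization_of_def by blast
  then show "u \<in> GL I" using x v unfolding GL_def by blast
qed (auto simp: GL_def)

lemma G_of_subset_GL: "carrier (G_of I) \<subseteq> GL I"
  by (simp add: carrier_G_of connected_component_subset)

lemma G_of_subset:
  assumes "closed_ideal I"
  shows "carrier (G_of I) \<subseteq> carrier GA"
proof -
  have "GL I \<subseteq> GL UNIV" using GL_iff[OF assms] GL_iff[OF closed_ideal_UNIV] by blast
  then show ?thesis by (simp add: carrier_G_of connected_component_mono)
qed

lemma G_of_form:
  assumes "u \<in> carrier (G_of I)"
  obtains x where "x \<in> I" "u = 1 + emb x"
  using assms G_of_subset_GL unfolding GL_def by blast

lemma G_of_mult:
  "closed_ideal I \<Longrightarrow> u \<in> carrier (G_of I) \<Longrightarrow> v \<in> carrier (G_of I) \<Longrightarrow> u * v \<in> carrier (G_of I)"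
  using monoid.m_closed[OF group.is_monoid[OF group_G_of], of I u v] by (simp add: G_of_simps)

lemma G_of_one: "closed_ideal I \<Longrightarrow> 1 \<in> carrier (G_of I)"
  using monoid.one_closed[OF group.is_monoid[OF group_G_of], of I] by (simp add: G_of_simps)

lemma GA_inv:
  assumes "u \<in> carrier GA"
  shows "u * ginv u = 1" "ginv u * u = 1" "ginv u \<in> carrier GA"
  using group.r_inv[OF group_GA assms] group.l_inv[OF group_GA assms]
    group.inv_closed[OF group_GA assms] by (simp_all add: G_of_simps)

lemma GA_inv_unique:
  assumes "u \<in> carrier GA" "v * u = 1"
  shows "ginv u = v"
  by (metis GA_inv(1)[OF assms(1)] assms(2) mult.assoc mult_1_left mult_1_right)

lemma GA_inv_mult:
  "u \<in> carrier GA \<Longrightarrow> v \<in> carrier GA \<Longrightarrow> ginv (u * v) = ginv v * ginv u"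
  using group.inv_mult_group[OF group_GA, of u v] by (simp add: G_of_simps)

lemma GA_inv_inv: "u \<in> carrier GA \<Longrightarrow> ginv (ginv u) = u"
  by (rule group.inv_inv[OF group_GA])

lemma GA_cancel:
  assumes "u \<in> carrier GA"
  shows "u * (ginv u * x) = x" "ginv u * (u * x) = x"
  using GA_inv[OF assms] by (simp_all add: mult.assoc[symmetric])

lemma gcomm_in_GA: "u \<in> carrier GA \<Longrightarrow> v \<in> carrier GA \<Longrightarrow> gcomm u v \<in> carrier GA"
  by (intro G_of_mult[OF closed_ideal_UNIV] GA_inv(3))

lemma ginv_gcomm: "u \<in> carrier GA \<Longrightarrow> v \<in> carrier GA \<Longrightarrow> ginv (gcomm u v) = gcomm v u"
  by (intro GA_inv_unique gcomm_in_GA) (simp_all add: mult.assoc GA_cancel GA_inv)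

lemma G_of_inv:
  assumes I: "closed_ideal I" and u: "u \<in> carrier (G_of I)"
  shows "ginv u \<in> carrier (G_of I)"
proof -
  have v: "inv\<^bsub>G_of I\<^esub> u \<in> carrier (G_of I)" "inv\<^bsub>G_of I\<^esub> u * u = 1"
    using group.inv_closed[OF group_G_of[OF I] u] group.l_inv[OF group_G_of[OF I] u]
    by (simp_all add: G_of_simps)
  then have "ginv u = inv\<^bsub>G_of I\<^esub> u" using G_of_subset[OF I] u by (intro GA_inv_unique) auto
  with v show ?thesis by simp
qed

lemma G_of_conjugate:
  assumes I: "closed_ideal I" and u: "u \<in> carrier GA" and v: "v \<in> carrier (G_of I)"
  shows "u * v * ginv u \<in> carrier (G_of I)"
proof -
  let ?f = "\<lambda>w. u * w * ginv u"
  have "?f ` GL I \<subseteq> GL I"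
  proof clarify
    fix w assume "w \<in> GL I"
    then obtain x w' where x: "x \<in> I" "w = 1 + emb x" and w': "w * w' = 1" "w' * w = 1"
      unfolding GL_iff[OF I] by blast
    have "u * emb x * ginv u \<in> emb ` I"
      using x(1) by (intro closed_ideal_mult_right closed_ideal_mult_left closed_ideal_emb[OF I]) simp
    then obtain y where y: "y \<in> I" "u * emb x * ginv u = emb y" by blast
    have "?f w = 1 + emb y" by (simp add: x(2) distrib_left distrib_right y GA_inv[OF u])
    moreover have "?f w * ?f w' = 1" "?f w' * ?f w = 1"
      using w' by (simp_all add: mult.assoc GA_cancel[OF u])
        (simp_all add: mult.assoc[symmetric] GA_inv[OF u])
    ultimately show "?f w \<in> GL I" unfolding GL_iff[OF I] using y(1) by blast
  qed
  then have sub: "?f ` carrier (G_of I) \<subseteq> GL I" using G_of_subset_GL by blast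
  have conn: "connected (?f ` carrier (G_of I))"
    unfolding carrier_G_of by (intro connected_continuous_image continuous_intros) simp
  have one: "1 \<in> ?f ` carrier (G_of I)"
    by (rule image_eqI[of _ _ 1]) (simp_all add: GA_inv[OF u] G_of_one[OF I])
  have "?f ` carrier (G_of I) \<subseteq> connected_component_set (GL I) 1"
    by (rule connected_component_maximal[OF one conn sub])
  with v show ?thesis unfolding carrier_G_of by blast
qed

text \<open>
  The segment from \<open>1\<close> to \<open>1 + x\<close> consists of invertible elements.
\<close>

lemma one_plus_small_in_G_of:
  assumes I: "closed_ideal I" and x: "x \<in> I" "norm x < 1"
  shows "1 + emb x \<in> carrier (G_of I)"
proof -
  define f where "f t = 1 + emb (t *\<^sub>R x)" for t :: real
  have sub: "f ` {0..1} \<subseteq> GL I"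
  proof clarify
    fix t :: real assume t: "t \<in> {0..1}"
    have "norm (- emb (t *\<^sub>R x)) < 1"
      using t x(2) mult_right_mono[of t 1 "norm x"] by (simp add: norm_emb)
    then obtain v where "(1 - - emb (t *\<^sub>R x)) * v = 1" "v * (1 - - emb (t *\<^sub>R x)) = 1"
      by (rule Neumann_inverse)
    then have "\<exists>v. f t * v = 1 \<and> v * f t = 1" by (auto simp: f_def)
    then show "f t \<in> GL I"
      unfolding GL_iff[OF I] using closed_ideal_scaleR[OF I x(1)] by (auto simp: f_def)
  qed
  have conn: "connected (f ` {0..1})"
    unfolding f_def emb_scaleR by (intro connected_continuous_image continuous_intros) simp
  have one: "1 \<in> f ` {0..1}" by (rule image_eqI[of _ _ 0]) (simp_all add: f_def emb_zero)
  have "f ` {0..1} \<subseteq> connected_component_set (GL I) 1"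
    by (rule connected_component_maximal[OF one conn sub])
  moreover have "f 1 \<in> f ` {0..1}" by simp
  ultimately show ?thesis unfolding carrier_G_of by (auto simp: f_def)
qed

text \<open>
  A connected group is generated by any neighbourhood of the identity: the truth value of \<open>P\<close> is locally
  constant, because \<open>u\<close> and a nearby \<open>w\<close> differ by the factor \<open>u\<^sup>-\<^sup>1 w\<close> close to \<open>1\<close>.
\<close>

lemma G_of_induct_small:
  assumes I: "closed_ideal I" and "\<delta> > 0"
    and small: "\<And>x. x \<in> I \<Longrightarrow> norm x \<le> \<delta> \<Longrightarrow> 1 + emb x \<in> carrier (G_of I) \<Longrightarrow> P (1 + emb x)"
    and mult: "\<And>u v. u \<in> carrier (G_of I) \<Longrightarrow> v \<in> carrier (G_of I) \<Longrightarrow> P u \<Longrightarrow> P v \<Longrightarrow> P (u * v)"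
    and inv: "\<And>u. u \<in> carrier (G_of I) \<Longrightarrow> P u \<Longrightarrow> P (ginv u)"
    and v: "v \<in> carrier (G_of I)"
  shows "P v"
proof -
  let ?C = "carrier (G_of I)"
  have "P 1 = P v"
  proof (rule connected_local_const[OF _ G_of_one[OF I] v])
    show "connected ?C" unfolding carrier_G_of by simp
    show "\<forall>u\<in>?C. \<forall>\<^sub>F w in at u within ?C. P u = P w"
    proof
      fix u assume u: "u \<in> ?C"
      then have u': "u \<in> carrier GA" using G_of_subset[OF I] by blast
      have "((\<lambda>w. norm (ginv u * (w - u))) \<longlongrightarrow> norm (ginv u * (u - u))) (at u within ?C)"
        by (intro tendsto_intros)
      then have "\<forall>\<^sub>F w in at u within ?C. norm (ginv u * (w - u)) < \<delta>"
        using \<open>\<delta> > 0\<close> by (auto dest: order_tendstoD(2))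
      moreover have "\<forall>\<^sub>F w in at u within ?C. w \<in> ?C" by (simp add: eventually_at_filter)
      ultimately show "\<forall>\<^sub>F w in at u within ?C. P u = P w"
      proof eventually_elim
        case (elim w)
        define z where "z = ginv u * w"
        have z: "z \<in> ?C" unfolding z_def by (intro G_of_mult[OF I] G_of_inv[OF I] u elim)
        then obtain x where x: "x \<in> I" "z = 1 + emb x" by (rule G_of_form)
        have "ginv u * (w - u) = emb x"
          using x(2) by (simp add: right_diff_distrib GA_inv[OF u'] z_def)
        then have "norm x \<le> \<delta>" using elim by (simp add: norm_emb)
        then have Pz: "P z" using small x z by blast
        have w: "w = u * z" by (simp add: z_def GA_cancel[OF u'])
        have "z \<in> carrier GA" using z G_of_subset[OF I] by blast
        then have "u = w * ginv z" by (simp add: w mult.assoc GA_inv)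
        then show ?case
          using mult[OF u z _ Pz] mult[OF elim(2) G_of_inv[OF I z] _ inv[OF z Pz]] w by metis
      qed
    qed
  qed
  moreover have "P 1"
    using small[of 0] closed_ideal_zero[OF I] \<open>\<delta> > 0\<close> G_of_one[OF I] by (simp add: emb_zero)
  ultimately show ?thesis by simp
qed


section \<open>Normal subgroups and their closures\<close>

lemma normal_GA_iff:
  "K \<lhd> GA \<longleftrightarrow> K \<subseteq> carrier GA \<and> 1 \<in> K \<and> (\<forall>k\<in>K. \<forall>l\<in>K. k * l \<in> K) \<and> (\<forall>k\<in>K. ginv k \<in> K)
    \<and> (\<forall>g\<in>carrier GA. \<forall>k\<in>K. g * k * ginv g \<in> K)"
  unfolding group.normal_inv_iff[OF group_GA] subgroup_def by (simp add: G_of_simps) blast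

text \<open>
  Continuity of inversion is proved along the way, from \<open>l\<^sup>-\<^sup>1 - k\<^sup>-\<^sup>1 = l\<^sup>-\<^sup>1 (k - l) k\<^sup>-\<^sup>1\<close>.
\<close>

lemma normal_closure:
  assumes K: "K \<lhd> GA"
  shows "carrier GA \<inter> closure K \<lhd> GA"
proof -
  have K': "K \<subseteq> carrier GA" "1 \<in> K" "\<And>k l. k \<in> K \<Longrightarrow> l \<in> K \<Longrightarrow> k * l \<in> K"
    "\<And>k. k \<in> K \<Longrightarrow> ginv k \<in> K" "\<And>g k. g \<in> carrier GA \<Longrightarrow> k \<in> K \<Longrightarrow> g * k * ginv g \<in> K"
    using K unfolding normal_GA_iff by blast+
  have mult: "k * l \<in> closure K" if kl: "k \<in> closure K" "l \<in> closure K" for k l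
  proof -
    obtain a b where "\<forall>n. a n \<in> K" "a \<longlonglongrightarrow> k" "\<forall>n. b n \<in> K" "b \<longlonglongrightarrow> l"
      using kl unfolding closure_sequential by blast
    then show ?thesis
      unfolding closure_sequential using K'(3) by (intro exI[of _ "\<lambda>n. a n * b n"]) (auto intro: tendsto_mult)
  qed
  have conj: "g * k * ginv g \<in> closure K" if gk: "g \<in> carrier GA" "k \<in> closure K" for g k
  proof -
    obtain a where "\<forall>n. a n \<in> K" "a \<longlonglongrightarrow> k" using gk(2) unfolding closure_sequential by blast
    then show ?thesis
      unfolding closure_sequential using K'(5)[OF gk(1)]
      by (intro exI[of _ "\<lambda>n. g * a n * ginv g"]) (auto intro!: tendsto_intros)
  qed
  have inv: "ginv k \<in> closure K" if k: "k \<in> carrier GA" "k \<in> closure K" for k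
    unfolding closure_approachable
  proof (intro allI impI)
    fix e :: real assume "e > 0"
    define m where "m = norm (ginv k) + 1"
    have m: "m > 0" by (simp add: m_def add_nonneg_pos)
    define \<delta> where "\<delta> = min (1 / (2 * m)) (e / (4 * m * m))"
    have "\<delta> > 0" using m \<open>e > 0\<close> by (simp add: \<delta>_def)
    then obtain l where l: "l \<in> K" "norm (k - l) < \<delta>"
      using closure_approachableD[OF k(2)] by (auto simp: dist_norm)
    have lG: "l \<in> carrier GA" using l K' by blast
    have eq: "ginv l - ginv k = ginv l * (k - l) * ginv k"
      by (simp add: algebra_simps GA_inv[OF k(1)] GA_cancel[OF lG])
    \<comment> \<open>The a priori bound \<open>norm (ginv l) \<le> 2 * m\<close> comes from \<open>norm (k - l) * norm (ginv k) \<le> 1 / 2\<close>.\<close>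
    have "norm (k - l) * norm (ginv k) \<le> 1 / (2 * m) * m"
      using l(2) m by (intro mult_mono) (auto simp: \<delta>_def m_def)
    also have "\<dots> = 1 / 2" using m by simp
    finally have half: "norm (k - l) * norm (ginv k) \<le> 1 / 2" .
    have le: "norm (ginv l - ginv k) \<le> norm (ginv l) * (norm (k - l) * norm (ginv k))"
      unfolding eq mult.assoc
      by (rule order_trans[OF norm_mult_ineq mult_left_mono[OF norm_mult_ineq]]) simp
    also have "\<dots> \<le> norm (ginv l) * (1 / 2)" using half by (rule mult_left_mono) simp
    finally have "norm (ginv l) \<le> 2 * m"
      using norm_triangle_sub[of "ginv l" "ginv k"] by (simp add: m_def)
    have "0 \<le> e / (4 * m * m)" using \<open>e > 0\<close> m by simp
    note le
    also have "norm (ginv l) * (norm (k - l) * norm (ginv k)) \<le> (2 * m) * (e / (4 * m * m) * m)"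
      using \<open>norm (ginv l) \<le> 2 * m\<close> l(2) m \<open>0 \<le> e / (4 * m * m)\<close> by (intro mult_mono) (auto simp: \<delta>_def m_def)
    also have "\<dots> = e / 2" using m by simp
    finally have "dist (ginv l) (ginv k) < e" using \<open>e > 0\<close> by (simp add: dist_norm)
    then show "\<exists>y\<in>K. dist y (ginv k) < e" using K'(4)[OF l(1)] by blast
  qed
  show ?thesis
    unfolding normal_GA_iff
    using mult conj inv K'(2) closure_subset[of K] G_of_one[OF closed_ideal_UNIV]
      G_of_mult[OF closed_ideal_UNIV] G_of_conjugate[OF closed_ideal_UNIV] GA_inv(3) by auto
qed

lemma commutator_subgroup_normal:
  fixes X :: "'a::cstar_algebra unitization set"
  assumes X: "X \<subseteq> carrier GA" "\<And>g x. g \<in> carrier GA \<Longrightarrow> x \<in> X \<Longrightarrow> g * x * ginv g \<in> X"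
  shows "commutator_subgroup GA X (carrier GA) \<lhd> GA"
  unfolding commutator_subgroup_def
proof (rule group.normal_generateI[OF group_GA])
  show "{x \<otimes>\<^bsub>GA\<^esub> y \<otimes>\<^bsub>GA\<^esub> ginv x \<otimes>\<^bsub>GA\<^esub> ginv y |x y. x \<in> X \<and> y \<in> carrier GA} \<subseteq> carrier GA"
    using X(1) gcomm_in_GA by (auto simp: G_of_simps(1))
  fix h g :: "'a unitization" assume g: "g \<in> carrier GA"
    and "h \<in> {x \<otimes>\<^bsub>GA\<^esub> y \<otimes>\<^bsub>GA\<^esub> ginv x \<otimes>\<^bsub>GA\<^esub> ginv y |x y. x \<in> X \<and> y \<in> carrier GA}"
  then obtain x y where h: "h = gcomm x y" and x: "x \<in> X" and y: "y \<in> carrier GA"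
    by (auto simp: G_of_simps(1))
  have xG: "x \<in> carrier GA" using x X by blast
  define x' y' where "x' = g * x * ginv g" and "y' = g * y * ginv g"
  have x': "x' \<in> X" using X(2)[OF g x] by (simp add: x'_def)
  have y': "y' \<in> carrier GA" unfolding y'_def by (intro G_of_mult[OF closed_ideal_UNIV] GA_inv(3) g y)
  have "ginv x' = g * ginv x * ginv g" "ginv y' = g * ginv y * ginv g"
    using x' X(1) y' g xG y by (auto intro!: GA_inv_unique simp: x'_def y'_def mult.assoc GA_cancel GA_inv)
  then have "g * h * ginv g = gcomm x' y'"
    by (simp add: h x'_def y'_def mult.assoc GA_cancel[OF g])
  then show "g \<otimes>\<^bsub>GA\<^esub> h \<otimes>\<^bsub>GA\<^esub> ginv g \<in>
      {x \<otimes>\<^bsub>GA\<^esub> y \<otimes>\<^bsub>GA\<^esub> ginv x \<otimes>\<^bsub>GA\<^esub> ginv y |x y. x \<in> X \<and> y \<in> carrier GA}"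
    using x' y' unfolding G_of_simps(1) by blast
qed

lemma gcomm_in_commutator_subgroup:
  assumes "x \<in> X" "y \<in> Y"
  shows "gcomm x y \<in> commutator_subgroup GA X Y"
  unfolding commutator_subgroup_def by (rule generate.incl) (use assms in \<open>auto simp: G_of_simps(1)\<close>)

lemma commutator_subgroup_subset:
  assumes N: "N \<lhd> GA" and "\<And>x y. x \<in> X \<Longrightarrow> y \<in> Y \<Longrightarrow> gcomm x y \<in> N"
  shows "commutator_subgroup GA X Y \<subseteq> N"
  unfolding commutator_subgroup_def
  by (rule group.generate_subgroup_incl[OF group_GA _ normal_imp_subgroup[OF N]])
    (use assms(2) in \<open>auto simp: G_of_simps(1)\<close>)


section \<open>Commutators and their tangent vectors\<close>

text \<open>
  Conjugation by \<open>u = 1 + r a\<close> preserves the tangent vectors, so \<open>u x u\<^sup>-\<^sup>1 - x = r [a, x] u\<^sup>-\<^sup>1\<close> is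
  tangent.  Divide by \<open>r\<close> and let \<open>r\<close> tend to \<open>0\<close>.
\<close>

lemma tangent_Lie_ideal:
  fixes K :: "'a::cstar_algebra unitization set"
  assumes K: "K \<lhd> GA" and x: "x \<in> tangent K"
  shows "x * emb a - emb a * x \<in> tangent K"
proof -
  have mult: "\<And>k l. k \<in> K \<Longrightarrow> l \<in> K \<Longrightarrow> k * l \<in> K" using K unfolding normal_GA_iff by blast
  define c where "c = emb a * x - x * emb a"
  have "c \<in> closure (tangent K)"
    unfolding closure_approachable
  proof (intro allI impI)
    fix e :: real assume "e > 0"
    define m where "m = norm c * 2 * norm a + 1"
    have m: "m > 0" by (simp add: m_def add_nonneg_pos)
    define p where "p = norm a + 1"
    define r where "r = min (1 / (2 * p)) (e / (2 * m))"
    have p: "p > 0" by (simp add: p_def add_nonneg_pos)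
    have r: "r > 0" "r * p \<le> 1 / 2" "r * m \<le> e / 2"
      using m p \<open>e > 0\<close> mult_right_mono[of r "1 / (2 * p)" p]
        mult_right_mono[of r "e / (2 * m)" m] by (auto simp: r_def)
    define u where "u = 1 + emb (r *\<^sub>R a)"
    have ra: "norm (r *\<^sub>R a) \<le> 1 / 2" using r by (simp add: p_def algebra_simps)
    have u: "u \<in> carrier GA"
      unfolding u_def using ra by (intro one_plus_small_in_G_of[OF closed_ideal_UNIV]) auto
    have nu: "norm (ginv u) \<le> 2"
    proof (rule norm_inverse_le_2[OF _ _ norm_1_le])
      show "(1 + emb (r *\<^sub>R a)) * ginv u = 1" using GA_inv(1)[OF u] by (simp add: u_def)
    qed (use ra in \<open>simp add: norm_emb\<close>)
    have "u * x * ginv u \<in> tangent K"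
      by (rule tangent_conjugate[OF GA_inv(1)[OF u] _ x]) (use K u in \<open>auto simp: normal_GA_iff\<close>)
    with tangent_diff[of K "u * x * ginv u" x] mult x have "u * x * ginv u - x \<in> tangent K" by blast
    moreover have "u * x * ginv u - x = (u * x - x * u) * ginv u"
      by (simp add: left_diff_distrib mult.assoc GA_inv[OF u])
    moreover have "u * x - x * u = r *\<^sub>R c"
      by (simp add: u_def c_def emb_scaleR algebra_simps)
    ultimately have "r *\<^sub>R (c * ginv u) \<in> tangent K" by simp
    from tangent_scaleR[OF this, of "1 / r"] r(1) have "c * ginv u \<in> tangent K" by simp
    moreover have "dist (c * ginv u) c < e"
    proof -
      have "c - c * ginv u = c * ((u - 1) * ginv u)"
        by (simp add: left_diff_distrib right_diff_distrib GA_inv[OF u])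
      also have "\<dots> = r *\<^sub>R (c * (emb a * ginv u))" by (simp add: u_def emb_scaleR)
      also have "norm \<dots> \<le> r * (norm c * (norm a * 2))"
      proof -
        have "norm (c * (emb a * ginv u)) \<le> norm c * (norm (emb a) * norm (ginv u))"
          by (rule order_trans[OF norm_mult_ineq mult_left_mono[OF norm_mult_ineq]]) simp
        also have "\<dots> \<le> norm c * (norm a * 2)"
          using nu by (simp add: norm_emb mult_left_mono)
        finally show ?thesis using r(1) by simp
      qed
      also have "\<dots> \<le> r * m" using r(1) by (intro mult_left_mono) (auto simp: m_def)
      also have "\<dots> < e" using r(3) \<open>e > 0\<close> by simp
      finally show ?thesis by (simp add: dist_norm norm_minus_commute)
    qed
    ultimately show "\<exists>y\<in>tangent K. dist y c < e" by blast
  qed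
  then have "c \<in> tangent K" using closed_tangent by (metis closure_closed)
  from tangent_minus[OF this] show ?thesis by (simp add: c_def)
qed

text \<open>
  For \<open>b = y g\<close>, the commutator of \<open>g\<close> with \<open>1 + s b\<close> is \<open>1 + s (g b g\<^sup>-\<^sup>1 - b)\<close> up to second order in
  \<open>s\<close>, and \<open>g b g\<^sup>-\<^sup>1 - b = g y - y g\<close>.
\<close>

lemma tangent_of_commutators:
  fixes K :: "'a::cstar_algebra unitization set"
  assumes g: "g \<in> carrier GA" and S: "closed_ideal S" and y: "y \<in> S"
    and K: "\<And>v. v \<in> carrier (G_of S) \<Longrightarrow> gcomm g v \<in> K"
  shows "g * emb y - emb y * g \<in> tangent K"
  unfolding tangent_def
proof (intro CollectI allI impI)
  fix \<epsilon> :: real assume "\<epsilon> > 0"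
  have "emb y * g \<in> emb ` S"
    by (rule closed_ideal_mult_right[OF closed_ideal_emb[OF S]]) (use y in simp)
  then obtain b where b: "b \<in> S" "emb y * g = emb b" by blast
  define d where "d = g * emb y - emb y * g"
  show "\<forall>\<^sub>F s in at 0. \<exists>k\<in>K. norm (k - 1 - s *\<^sub>R (g * emb y - emb y * g)) \<le> \<epsilon> * \<bar>s\<bar>"
    using eventually_abs_mult_le[OF half_gt_zero[OF zero_less_one], of "norm b"]
      eventually_abs_mult_le[OF \<open>\<epsilon> > 0\<close>, of "norm d * norm b * 2"]
  proof eventually_elim
    case (elim s)
    define v where "v = 1 + emb (s *\<^sub>R b)"
    have sb: "norm (s *\<^sub>R b) \<le> 1 / 2" using elim by simp
    then have vS: "v \<in> carrier (G_of S)"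
      unfolding v_def by (intro one_plus_small_in_G_of[OF S] closed_ideal_scaleR[OF S] b) simp
    then have v: "v \<in> carrier GA" using G_of_subset[OF S] by blast
    have nv: "norm (ginv v) \<le> 2"
    proof (rule norm_inverse_le_2[OF _ _ norm_1_le])
      show "(1 + emb (s *\<^sub>R b)) * ginv v = 1" using GA_inv(1)[OF v] by (simp add: v_def)
    qed (use sb in \<open>simp add: norm_emb\<close>)
    have gb: "g * emb b * ginv g = g * emb y"
      by (simp add: b(2)[symmetric] mult.assoc GA_inv[OF g])
    have "gcomm g v = (1 + s *\<^sub>R (g * emb y)) * ginv v"
      using gb by (simp add: v_def emb_scaleR distrib_left distrib_right GA_inv[OF g] mult.assoc)
    moreover have "1 + s *\<^sub>R d = ((1 + s *\<^sub>R d) * v) * ginv v" by (simp add: mult.assoc GA_inv[OF v])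
    ultimately have "gcomm g v - (1 + s *\<^sub>R d) = ((1 + s *\<^sub>R (g * emb y)) - (1 + s *\<^sub>R d) * v) * ginv v"
      by (simp add: left_diff_distrib)
    also have "(1 + s *\<^sub>R (g * emb y)) - (1 + s *\<^sub>R d) * v = - ((s * s) *\<^sub>R (d * emb b))"
      by (simp add: v_def emb_scaleR d_def b(2)[symmetric] algebra_simps)
    finally have "gcomm g v - 1 - s *\<^sub>R d = - ((s * s) *\<^sub>R (d * (emb b * ginv v)))"
      by (simp add: diff_diff_eq mult.assoc)
    then have eq: "norm (gcomm g v - 1 - s *\<^sub>R d) = \<bar>s\<bar> * (\<bar>s\<bar> * norm (d * (emb b * ginv v)))"
      by (simp only: norm_minus_cancel norm_scaleR abs_mult mult.assoc)
    have "norm (d * (emb b * ginv v)) \<le> norm d * (norm (emb b) * norm (ginv v))"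
      by (rule order_trans[OF norm_mult_ineq mult_left_mono[OF norm_mult_ineq]]) simp
    also have "\<dots> \<le> norm d * (norm b * 2)"
      using nv by (simp add: norm_emb mult_left_mono)
    finally have "norm (gcomm g v - 1 - s *\<^sub>R d) \<le> \<bar>s\<bar> * (\<bar>s\<bar> * (norm d * (norm b * 2)))"
      unfolding eq by (intro mult_left_mono) auto
    also have "\<dots> \<le> \<bar>s\<bar> * \<epsilon>" using elim by (intro mult_left_mono) (auto simp: mult.assoc)
    finally show ?case using K[OF vS] unfolding d_def by (auto simp: mult.commute)
  qed
qed

text \<open>
  The resolvent identity \<open>U s - U t = - (s - t) U s X U t\<close>, used twice, bounds the remainder
  quadratically.
\<close>

lemma has_vector_derivative_inverse_line:
  fixes X :: "'b::{real_normed_algebra, monoid_mult}" and U :: "real \<Rightarrow> 'b"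
  assumes U: "\<And>t. t \<in> T \<Longrightarrow> (1 + t *\<^sub>R X) * U t = 1" "\<And>t. t \<in> T \<Longrightarrow> U t * (1 + t *\<^sub>R X) = 1"
    and bd: "\<And>t. t \<in> T \<Longrightarrow> norm (U t) \<le> M" and t: "t \<in> T"
  shows "(U has_vector_derivative - (U t * X * U t)) (at t within T)"
  unfolding has_vector_derivative_def has_derivative_within_alt
proof (intro conjI allI impI)
  show "bounded_linear (\<lambda>h. h *\<^sub>R - (U t * X * U t))" by (rule bounded_linear_scaleR_left)
  fix e :: real assume "e > 0"
  define Y where "Y = X * U t * X * U t"
  have "M \<ge> 0" using bd[OF t] norm_ge_zero order_trans by blast
  then have m: "M * norm Y + 1 > 0" by (simp add: add_nonneg_pos)
  have "norm (U s - U t - (s - t) *\<^sub>R - (U t * X * U t)) \<le> e * norm (s - t)"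
    if s: "s \<in> T" and near: "norm (s - t) < e / (M * norm Y + 1)" for s
  proof -
    have diff: "U s - U t = - ((s - t) *\<^sub>R (U s * X * U t))"
    proof -
      have "(t - s) *\<^sub>R X = (1 + t *\<^sub>R X) - (1 + s *\<^sub>R X)" by (simp add: algebra_simps)
      then have "(t - s) *\<^sub>R (U s * X * U t) = U s * ((1 + t *\<^sub>R X) - (1 + s *\<^sub>R X)) * U t"
        by (metis mult_scaleR_left mult_scaleR_right)
      also have "\<dots> = U s * ((1 + t *\<^sub>R X) * U t) - (U s * (1 + s *\<^sub>R X)) * U t"
        by (simp only: left_diff_distrib right_diff_distrib mult.assoc)
      also have "\<dots> = U s - U t" by (simp only: U s t mult_1_left mult_1_right)
      finally have "U s - U t = (t - s) *\<^sub>R (U s * X * U t)" ..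
      then show ?thesis by (simp add: scaleR_left_diff_distrib)
    qed
    have "U s - U t - (s - t) *\<^sub>R - (U t * X * U t) = - ((s - t) *\<^sub>R ((U s - U t) * X * U t))"
      unfolding diff[THEN arg_cong[of _ _ "\<lambda>z. z - _"]]
      by (simp add: left_diff_distrib scaleR_diff_right)
    also have "\<dots> = ((s - t) * (s - t)) *\<^sub>R (U s * Y)"
      unfolding diff by (simp add: Y_def mult.assoc)
    finally have eq: "norm (U s - U t - (s - t) *\<^sub>R - (U t * X * U t)) = \<bar>s - t\<bar> * (\<bar>s - t\<bar> * norm (U s * Y))"
      by (simp only: norm_scaleR abs_mult mult.assoc)
    have "norm (U s * Y) \<le> M * norm Y + 1"
      using order_trans[OF norm_mult_ineq mult_right_mono[OF bd[OF s]], of Y] by simp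
    then have "\<bar>s - t\<bar> * norm (U s * Y) \<le> \<bar>s - t\<bar> * (M * norm Y + 1)" by (rule mult_left_mono) simp
    also have "\<dots> \<le> e" using near m by (simp add: pos_less_divide_eq)
    finally have "\<bar>s - t\<bar> * (\<bar>s - t\<bar> * norm (U s * Y)) \<le> \<bar>s - t\<bar> * e" by (rule mult_left_mono) simp
    then show ?thesis unfolding eq by (simp add: mult.commute)
  qed
  then show "\<exists>d>0. \<forall>y\<in>T. norm (y - t) < d \<longrightarrow>
      norm (U y - U t - (y - t) *\<^sub>R - (U t * X * U t)) \<le> e * norm (y - t)"
    using \<open>e > 0\<close> m by (intro exI[of _ "e / (M * norm Y + 1)"]) auto
qed

text \<open>
  The path \<open>d t = g u g\<^sup>-\<^sup>1 u\<^sup>-\<^sup>1\<close> with \<open>u = 1 + t x\<close> joins \<open>1\<close> to the commutator.  Its velocity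
  \<open>d\<^sup>-\<^sup>1 d'\<close> is the conjugate by \<open>u\<close> of \<open>g y g\<^sup>-\<^sup>1 - y = [g, y g\<^sup>-\<^sup>1]\<close> with \<open>y = u\<^sup>-\<^sup>1 x\<close> in the ideal, and
  this is tangent by hypothesis.
\<close>

lemma small_commutators_of_tangent:
  fixes K :: "'a::cstar_algebra unitization set"
  assumes K: "K \<lhd> GA" and S: "closed_ideal S" and g: "g \<in> carrier GA"
    and tan: "\<And>y. y \<in> S \<Longrightarrow> g * emb y - emb y * g \<in> tangent K"
    and x: "x \<in> S" "norm x \<le> 1 / 2"
  shows "gcomm g (1 + emb x) \<in> closure K"
proof -
  define X where "X = emb x"
  define u where "u t = 1 + t *\<^sub>R X" for t :: real
  define U where "U t = ginv (u t)" for t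
  have small: "norm (t *\<^sub>R X) \<le> 1 / 2" if "t \<in> {0..1}" for t :: real
    using that x(2) mult_mono[of t 1 "norm x" "1 / 2"] by (simp add: X_def norm_emb)
  have uS: "u t \<in> carrier (G_of S)" if "t \<in> {0..1}" for t
    using one_plus_small_in_G_of[OF S closed_ideal_scaleR[OF S x(1), of t]] small[OF that]
    by (simp add: u_def X_def emb_scaleR norm_emb)
  then have u: "u t \<in> carrier GA" if "t \<in> {0..1}" for t using G_of_subset[OF S] that by blast
  note cancel = GA_inv[OF g] GA_cancel[OF g]
  have uU: "u t * U t = 1" "U t * u t = 1" "u t * (U t * z) = z" "U t * (u t * z) = z"
    if "t \<in> {0..1}" for t z
    using GA_inv[OF u[OF that]] GA_cancel[OF u[OF that]] by (simp_all add: U_def)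
  have nU: "norm (U t) \<le> 2" if "t \<in> {0..1}" for t
  proof (rule norm_inverse_le_2[OF _ small[OF that] norm_1_le])
    show "(1 + t *\<^sub>R X) * U t = 1" using uU(1)[OF that] by (simp add: u_def)
  qed
  define d where "d t = g * u t * ginv g * U t" for t
  define D where "D t = u t * g * U t * ginv g" for t
  define y where "y t = U t * X" for t
  define l where "l t = u t * (g * y t * ginv g - y t) * U t" for t
  have "d 1 \<in> closure K"
  proof (rule path_with_tangent_velocity_ends_in_closure[OF norm_1_le])
    show "1 \<in> K" "\<And>k l. k \<in> K \<Longrightarrow> l \<in> K \<Longrightarrow> k * l \<in> K" using K unfolding normal_GA_iff by blast+
    fix t :: real assume t: "t \<in> {0..1}"
    show "d t * D t = 1" "D t * d t = 1"
      by (simp_all add: d_def D_def mult.assoc cancel uU[OF t])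
    have "norm (u t) \<le> 2"
      using norm_triangle_ineq[of 1 "t *\<^sub>R X"] small[OF t] norm_1_le[where 'b="'a unitization"]
      unfolding u_def by linarith
    then have "norm (u t * g * U t * ginv g) \<le> 2 * norm g * 2 * norm (ginv g)"
      using nU[OF t] by (intro order_trans[OF norm_mult_ineq] mult_mono) auto
    then show "norm (D t) \<le> 2 * norm g * 2 * norm (ginv g)" by (simp add: D_def)
    have "(U has_vector_derivative - (U t * X * U t)) (at t within {0..1})"
      by (rule has_vector_derivative_inverse_line[OF _ _ nU t]) (use uU in \<open>simp_all add: u_def\<close>)
    moreover have "((\<lambda>t. g * u t * ginv g) has_vector_derivative g * X * ginv g) (at t within {0..1})"
      unfolding u_def by (auto intro!: derivative_eq_intros has_vector_derivative_mult_left has_vector_derivative_mult_right)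
    ultimately have "(d has_vector_derivative
        (g * u t * ginv g) * - (U t * X * U t) + (g * X * ginv g) * U t) (at t within {0..1})"
      unfolding d_def by (intro has_vector_derivative_mult)
    also have "(g * u t * ginv g) * - (U t * X * U t) + (g * X * ginv g) * U t = d t * l t"
      by (simp add: d_def l_def y_def left_diff_distrib right_diff_distrib mult.assoc cancel uU[OF t])
    finally show "(d has_vector_derivative d t * l t) (at t within {0..1})" .
    have "y t * ginv g \<in> emb ` S"
      unfolding y_def X_def using x(1)
      by (intro closed_ideal_mult_right closed_ideal_mult_left closed_ideal_emb[OF S]) simp
    then obtain z where z: "z \<in> S" "y t * ginv g = emb z" by blast
    have "g * y t * ginv g - y t = g * emb z - emb z * g"
      by (simp add: z(2)[symmetric] mult.assoc cancel)
    also have "\<dots> \<in> tangent K" by (rule tan[OF z(1)])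
    finally have "u t * (g * y t * ginv g - y t) * U t \<in> tangent K"
      by (rule tangent_conjugate[OF uU(1)[OF t], rotated])
        (use K u[OF t] in \<open>auto simp: normal_GA_iff U_def\<close>)
    then show "l t \<in> tangent K" by (simp add: l_def)
  next
    have "U 0 = 1" using uU(1)[of 0] by (simp add: u_def)
    then show "d 0 = 1" by (simp add: d_def u_def cancel)
  qed
  then show ?thesis by (simp add: d_def U_def u_def X_def)
qed

text \<open>
  The converse of \<open>tangent_of_commutators\<close>, up to closure.  The elements whose commutator with \<open>g\<close> lies
  in the normal subgroup \<open>carrier GA \<inter> closure K\<close> form a subgroup, by the usual identities for
  commutators of products and inverses, so it suffices to consider elements near \<open>1\<close>.
\<close>

lemma commutators_of_tangent:
  fixes K :: "'a::cstar_algebra unitization set"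
  assumes K: "K \<lhd> GA" and S: "closed_ideal S" and g: "g \<in> carrier GA"
    and tan: "\<And>y. y \<in> S \<Longrightarrow> g * emb y - emb y * g \<in> tangent K"
    and v: "v \<in> carrier (G_of S)"
  shows "gcomm g v \<in> closure K"
proof -
  let ?N = "carrier GA \<inter> closure K"
  have N: "?N \<lhd> GA" by (rule normal_closure[OF K])
  then have N_mult: "k * l \<in> ?N" if "k \<in> ?N" "l \<in> ?N" for k l using that unfolding normal_GA_iff by blast
  have N_inv: "ginv k \<in> ?N" if "k \<in> ?N" for k using N that unfolding normal_GA_iff by blast
  have N_conj: "h * k * ginv h \<in> ?N" if "h \<in> carrier GA" "k \<in> ?N" for h k
    using N that unfolding normal_GA_iff by blast
  have "gcomm g v \<in> ?N"
  proof (rule G_of_induct_small[OF S _ _ _ _ v])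
    show "(0 :: real) < 1 / 2" by simp
  next
    fix x assume "x \<in> S" "norm x \<le> 1 / 2" "1 + emb x \<in> carrier (G_of S)"
    then show "gcomm g (1 + emb x) \<in> ?N"
      using small_commutators_of_tangent[OF K S g tan] gcomm_in_GA[OF g] G_of_subset[OF S] by blast
  next
    fix u w assume "u \<in> carrier (G_of S)" "w \<in> carrier (G_of S)" and N: "gcomm g u \<in> ?N" "gcomm g w \<in> ?N"
    then have u: "u \<in> carrier GA" and w: "w \<in> carrier GA" using G_of_subset[OF S] by blast+
    have "gcomm g (u * w) = gcomm g u * (u * gcomm g w * ginv u)"
      by (simp add: GA_inv_mult[OF u w] mult.assoc GA_cancel[OF g] GA_cancel[OF u])
    then show "gcomm g (u * w) \<in> ?N" using N_mult[OF N(1) N_conj[OF u N(2)]] by simp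
  next
    fix u assume "u \<in> carrier (G_of S)" and N: "gcomm g u \<in> ?N"
    then have u: "u \<in> carrier GA" using G_of_subset[OF S] by blast
    have "gcomm g (ginv u) = ginv u * ginv (gcomm g u) * ginv (ginv u)"
      unfolding ginv_gcomm[OF g u] GA_inv_inv[OF u]
      by (simp add: mult.assoc GA_cancel[OF u] GA_inv[OF u])
    then show "gcomm g (ginv u) \<in> ?N"
      using N_conj[OF GA_inv(3)[OF u] N_inv[OF N]] by simp
  qed
  then show ?thesis by simp
qed


section \<open>The two commutator subgroups\<close>

theorem theorem1p1:
  fixes H :: "'a::cstar_algebra unitization set" and I :: "'a set"
  assumes "H \<lhd> G_of (UNIV :: 'a set)"
    and "closedin (top_of_set (carrier (G_of (UNIV :: 'a set)))) H"
    and "I = closed_ideal hull (emb -` lie_bracket H (range emb))"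
  shows "top_of_set (carrier (G_of (UNIV :: 'a set))) closure_of
           commutator_subgroup (G_of UNIV) H (carrier (G_of UNIV)) =
         top_of_set (carrier (G_of (UNIV :: 'a set))) closure_of
           commutator_subgroup (G_of UNIV) (carrier (G_of I)) (carrier (G_of UNIV))"
proof -
  define X where "X = commutator_subgroup GA H (carrier GA)"
  define Y where "Y = commutator_subgroup GA (carrier (G_of I)) (carrier GA)"
  have H: "H \<subseteq> carrier GA" "\<And>g h. g \<in> carrier GA \<Longrightarrow> h \<in> H \<Longrightarrow> g * h * ginv g \<in> H"
    using assms(1) unfolding normal_GA_iff by blast+
  have I: "closed_ideal I" unfolding assms(3) by (rule closed_ideal_hull)
  have GI: "carrier (G_of I) \<subseteq> carrier GA" by (rule G_of_subset[OF I])
  have X: "X \<lhd> GA" unfolding X_def by (rule commutator_subgroup_normal[OF H])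
  have Y: "Y \<lhd> GA"
    unfolding Y_def by (rule commutator_subgroup_normal[OF GI G_of_conjugate[OF I]])
  have XG: "X \<subseteq> carrier GA" and YG: "Y \<subseteq> carrier GA"
    using X Y unfolding normal_GA_iff by blast+

  \<comment> \<open>As \<open>[1 + k, a] = [k, a]\<close>, the brackets with \<open>H\<close> are commutators inside \<open>A\<close> with elements of \<open>M\<close>.\<close>
  define M where "M = {k. 1 + emb k \<in> H}"
  have H_comm: "h * emb a - emb a * h = emb (k * a - a * k)" if "h = 1 + emb k" for h k a
    using that by (simp add: emb_diff emb_mult distrib_left distrib_right)
  have H_form: "\<exists>k\<in>M. h = 1 + emb k" if "h \<in> H" for h
  proof -
    have "h \<in> carrier GA" using that H(1) by blast
    then obtain k where "h = 1 + emb k" by (rule G_of_form)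
    then show ?thesis using that by (auto simp: M_def)
  qed
  have bracket: "h * emb a - emb a * h \<in> emb ` I" if h: "h \<in> H" for h a
  proof -
    obtain k where k: "h = 1 + emb k" using H_form[OF h] by blast
    have "h * emb a - emb a * h \<in> lie_bracket H (range emb)"
      unfolding lie_bracket_def by (rule complex_vector.span_base) (use h in blast)
    then have "k * a - a * k \<in> emb -` lie_bracket H (range emb)" by (simp add: H_comm[OF k])
    then have "k * a - a * k \<in> I"
      unfolding assms(3) using hull_subset[of "emb -` lie_bracket H (range emb)" closed_ideal] by blast
    then show ?thesis unfolding H_comm[OF k] by simp
  qed

  define J where "J = closed_ideal hull {k * a - a * k |k a. k \<in> M}"
  have J: "closed_ideal J" unfolding J_def by (rule closed_ideal_hull)
  have "I \<subseteq> J"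
    unfolding assms(3)
  proof (rule hull_minimal[where S = closed_ideal, OF _ J])
    have "lie_bracket H (range emb) \<subseteq> emb ` J"
      unfolding lie_bracket_def
    proof (rule complex_vector.span_minimal)
      show "complex_vector.subspace (emb ` J)"
        using closed_ideal_emb[OF J] by (simp add: closed_ideal_def)
      show "{x * y - y * x |x y. x \<in> H \<and> y \<in> range emb} \<subseteq> emb ` J"
      proof clarify
        fix h a assume "h \<in> H"
        then obtain k where k: "k \<in> M" "h = 1 + emb k" using H_form by blast
        have "k * a - a * k \<in> J"
          unfolding J_def using k(1) by (intro hull_inc) blast
        then show "h * emb a - emb a * h \<in> emb ` J" unfolding H_comm[OF k(2)] by simp
      qed
    qed
    then show "emb -` lie_bracket H (range emb) \<subseteq> J" using inj_image_mem_iff[OF inj_emb] by blast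
  qed

  \<comment> \<open>The closed Lie ideal \<open>{a. emb a \<in> tangent X}\<close> contains \<open>[M, A]\<close>, hence also \<open>[I, A]\<close>.\<close>
  have X_tan: "x * b - b * x \<in> emb -` tangent X" if x: "x \<in> I" for x b
  proof (rule Lie_ideal_contains_commutators_of_ideal[of _ M])
    have mult: "\<And>k l. k \<in> X \<Longrightarrow> l \<in> X \<Longrightarrow> k * l \<in> X" and one: "1 \<in> X"
      using X unfolding normal_GA_iff by blast+
    show "closed (emb -` tangent X)"
      by (intro closed_vimage closed_tangent linear_continuous_on bounded_linear_emb)
    show "0 \<in> emb -` tangent X" using tangent_zero[OF one] by (simp add: emb_zero)
    show "\<And>x y. x \<in> emb -` tangent X \<Longrightarrow> y \<in> emb -` tangent X \<Longrightarrow> x + y \<in> emb -` tangent X"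
      using tangent_add[OF mult] by (simp add: emb_add)
    show "\<And>x. x \<in> emb -` tangent X \<Longrightarrow> - x \<in> emb -` tangent X"
      using tangent_minus by (simp add: emb_minus)
    show "\<And>x a. x \<in> emb -` tangent X \<Longrightarrow> x * a - a * x \<in> emb -` tangent X"
      using tangent_Lie_ideal[OF X] by (simp add: emb_diff emb_mult)
    show "x \<in> closed_ideal hull {k * a - a * k |k a. k \<in> M}" using x \<open>I \<subseteq> J\<close> by (auto simp: J_def)
    fix k a assume "k \<in> M"
    then have h: "1 + emb k \<in> H" by (simp add: M_def)
    have "(1 + emb k) * emb a - emb a * (1 + emb k) \<in> tangent X"
    proof (rule tangent_of_commutators[OF _ closed_ideal_UNIV])
      show "1 + emb k \<in> carrier GA" using h H(1) by blast
      show "gcomm (1 + emb k) v \<in> X" if "v \<in> carrier GA" for v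
        unfolding X_def by (rule gcomm_in_commutator_subgroup[OF h that])
    qed simp
    then show "k * a - a * k \<in> emb -` tangent X" using H_comm[of "1 + emb k" k a] by simp
  qed
  have "Y \<subseteq> carrier GA \<inter> closure X"
    unfolding Y_def
  proof (rule commutator_subgroup_subset[OF normal_closure[OF X]])
    fix v g :: "'a unitization" assume v: "v \<in> carrier (G_of I)" and g: "g \<in> carrier GA"
    obtain a where a: "g = 1 + emb a" using g by (rule G_of_form)
    have "gcomm g v \<in> closure X"
    proof (rule commutators_of_tangent[OF X I g _ v])
      fix y assume "y \<in> I"
      from tangent_minus[OF X_tan[OF this, of a, unfolded vimage_eq]]
      show "g * emb y - emb y * g \<in> tangent X"
        unfolding H_comm[OF a] by (simp add: emb_minus[symmetric])
    qed
    moreover have "v \<in> carrier GA" using v GI by blast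
    moreover have "ginv (gcomm g v) \<in> carrier GA \<inter> closure X" if "gcomm g v \<in> carrier GA \<inter> closure X"
      using normal_closure[OF X] that unfolding normal_GA_iff by blast
    ultimately show "gcomm v g \<in> carrier GA \<inter> closure X"
      using ginv_gcomm[OF g, of v] gcomm_in_GA[OF g, of v] by auto
  qed
  moreover have "X \<subseteq> carrier GA \<inter> closure Y"
    unfolding X_def
  proof (rule commutator_subgroup_subset[OF normal_closure[OF Y]])
    fix h g :: "'a unitization" assume h: "h \<in> H" and g: "g \<in> carrier GA"
    have hG: "h \<in> carrier GA" using h H(1) by blast
    have Y_tan: "h * emb y - emb y * h \<in> tangent Y" if "y \<in> I" for y
    proof (rule tangent_of_commutators[OF hG I that])
      fix v assume v: "v \<in> carrier (G_of I)"
      then have "gcomm v h \<in> Y" unfolding Y_def by (rule gcomm_in_commutator_subgroup[OF _ hG])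
      then have "ginv (gcomm v h) \<in> Y" using Y unfolding normal_GA_iff by blast
      then show "gcomm h v \<in> Y" using ginv_gcomm[of v h] v GI hG by auto
    qed
    have "gcomm h g \<in> closure Y"
    proof (rule commutators_of_tangent[OF Y closed_ideal_UNIV hG _ g])
      fix a
      \<comment> \<open>Only \<open>[h, I]\<close> is known to be tangent to \<open>Y\<close>, but \<open>[h, A] \<subseteq> I\<close> makes \<open>[h, A]\<close> a limit of it.\<close>
      have "h * emb a - emb a * h \<in> closure {h * y - y * h |y. y \<in> emb ` I}"
        by (rule commutators_in_ideal_approximable[OF closed_ideal_emb[OF I] bracket[OF h]])
      also have "closure {h * y - y * h |y. y \<in> emb ` I} \<subseteq> tangent Y"
        by (rule closure_minimal[OF _ closed_tangent]) (use Y_tan in auto)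
      finally show "h * emb a - emb a * h \<in> tangent Y" .
    qed
    then show "gcomm h g \<in> carrier GA \<inter> closure Y" using gcomm_in_GA[OF hG g] by simp
  qed
  ultimately have "closure X = closure Y"
    by (metis closure_minimal closed_closure le_inf_iff subset_antisym)
  then show ?thesis
    using closure_of_eq_iff[OF XG YG] unfolding X_def Y_def by simp
qed

end
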